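(* If $G$ is a cut-group, then $G/N$ is a cut-group for every finite normal subgroup $N$ of $G$.
   Context: For a group $G$ (possibly infinite), $\mathcal{U}(\mathbb{Z}[G])$ is the group of units of the integral group ring $\mathbb{Z}[G]$, $\mathcal{Z}(\mathcal{U}(\mathbb{Z}[G]))$ is its center, and $\mathcal{Z}(G)$ is the center of $G$. $G$ is called a cut-group if all central units of $\mathbb{Z}[G]$ are trivial, i.e. $\mathcal{Z}(\mathcal{U}(\mathbb{Z}[G]))=\pm\mathcal{Z}(G)$. *)

theory Defs
  imports "HOL-Algebra.Algebra" "HOL-Library.Poly_Mapping"
begin

(* Elements are finitely supported functions, so infinite groups are covered. The product is the
   bilinear extension of frag_of x * frag_of y = frag_of (x \<otimes> y) (frag_extend is linear extension). *)
definition integral_group_ring :: "('a, 'm) monoid_scheme \<Rightarrow> ('a \<Rightarrow>\<^sub>0 int) ring"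
  where "integral_group_ring G =
    \<lparr>carrier = {f. Poly_Mapping.keys f \<subseteq> carrier G},
     monoid.mult = (\<lambda>f g. frag_extend (\<lambda>x. frag_extend (\<lambda>y. frag_of (x \<otimes>\<^bsub>G\<^esub> y)) g) f),
     monoid.one = frag_of \<one>\<^bsub>G\<^esub>,
     ring.zero = 0,
     ring.add = (+)\<rparr>"

definition center :: "('a, 'm) monoid_scheme \<Rightarrow> 'a set"
  where "center G = {z \<in> carrier G. \<forall>x \<in> carrier G. z \<otimes>\<^bsub>G\<^esub> x = x \<otimes>\<^bsub>G\<^esub> z}"

definition cut_group :: "('a, 'm) monoid_scheme \<Rightarrow> bool"
  where "cut_group G \<longleftrightarrow> group G \<and>
    center (units_of (integral_group_ring G)) =
      frag_of ` center G \<union> (\<lambda>z. - frag_of z) ` center G"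

lemma frag_extend_fun_add:
  "frag_extend (\<lambda>x. a x + b x) f = frag_extend a f + frag_extend b f"
  by (simp add: frag_extend_def frag_cmul_distrib2 sum.distrib)

lemma frag_extend_fun_cmul:
  "frag_extend (\<lambda>x. frag_cmul c (a x)) f = frag_cmul c (frag_extend a f)"
  by (simp add: frag_extend_def frag_cmul_sum mult.commute)

lemma frag_extend_compose:
  "frag_extend a (frag_extend b f) = frag_extend (\<lambda>x. frag_extend a (b x)) f"
  by (simp add: frag_extend_def[of b f] frag_extend_def[of "\<lambda>x. frag_extend a (b x)" f]
      frag_extend_sum frag_extend_cmul o_def)

lemma ring_integral_group_ring:
  assumes "group G"
  shows "ring (integral_group_ring G)"
proof -
  interpret group G by fact
  have keys: "Poly_Mapping.keys (frag_extend (\<lambda>x. frag_extend (\<lambda>y. frag_of (x \<otimes>\<^bsub>G\<^esub> y)) g) f)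
      \<subseteq> carrier G"
    if "Poly_Mapping.keys f \<subseteq> carrier G" "Poly_Mapping.keys g \<subseteq> carrier G" for f g
    using that by (fastforce dest!: subsetD[OF keys_frag_extend])
  have ident: "frag_extend (\<lambda>y. frag_of (\<one>\<^bsub>G\<^esub> \<otimes>\<^bsub>G\<^esub> y)) f = f"
    "frag_extend (\<lambda>x. frag_of (x \<otimes>\<^bsub>G\<^esub> \<one>\<^bsub>G\<^esub>)) f = f"
    if "Poly_Mapping.keys f \<subseteq> carrier G" for f
    using that by (auto intro!: trans[OF frag_extend_eq frag_expansion[symmetric]])
  have "frag_extend (\<lambda>x. frag_extend (\<lambda>y. frag_of (x \<otimes>\<^bsub>G\<^esub> y)) h)
          (frag_extend (\<lambda>x. frag_extend (\<lambda>y. frag_of (x \<otimes>\<^bsub>G\<^esub> y)) g) f) =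
        frag_extend (\<lambda>x. frag_extend (\<lambda>y. frag_of (x \<otimes>\<^bsub>G\<^esub> y))
          (frag_extend (\<lambda>x. frag_extend (\<lambda>y. frag_of (x \<otimes>\<^bsub>G\<^esub> y)) h) g)) f"
    if "Poly_Mapping.keys f \<subseteq> carrier G" "Poly_Mapping.keys g \<subseteq> carrier G"
      "Poly_Mapping.keys h \<subseteq> carrier G" for f g h
    unfolding frag_extend_compose using that
    by (auto intro!: frag_extend_eq simp: m_assoc subset_iff)
  note assoc = this
  show ?thesis
  proof (rule ringI)
    show "abelian_group (integral_group_ring G)"
    proof (rule abelian_groupI)
      fix f assume "f \<in> carrier (integral_group_ring G)"
      then show "\<exists>g \<in> carrier (integral_group_ring G).
          g \<oplus>\<^bsub>integral_group_ring G\<^esub> f = \<zero>\<^bsub>integral_group_ring G\<^esub>"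
        by (intro bexI[of _ "- f"]) (auto simp: integral_group_ring_def)
    qed (use keys_add in \<open>force simp: integral_group_ring_def algebra_simps\<close>)+
    show "monoid (integral_group_ring G)"
      by (rule monoidI) (simp_all add: integral_group_ring_def keys ident assoc)
  qed (simp_all add: integral_group_ring_def frag_extend_add frag_extend_fun_add)
qed

end

theory Submission
  imports Defs
begin

text \<open>
  Let \<open>Q = G/N\<close>, \<open>n = |N|\<close>, and let \<open>u\<close> be a central
  unit of \<open>\<int>[Q]\<close>. Multiplying a lift of \<open>y\<close> by the sum of the elements of \<open>N\<close>
  turns a central unit \<open>1 + n y\<close> of \<open>\<int>[Q]\<close> into the image of a central unit of \<open>\<int>[G]\<close>,
  so such a unit is trivial. The
  idea is to reach this form from \<open>s = u u*\<close>, where \<open>*\<close> inverts group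
  elements. The center of \<open>\<int>[Q]\<close> is reduced and has no nontrivial
  idempotents, because \<open>x x* = 0\<close> only for \<open>x = 0\<close>; hence
  \<open>u\<close> is homogeneous for every real grading, and the support of \<open>s\<close>
  consists of torsion elements with finitely many conjugates. By Dietzmann's lemma it
  generates a finite group, so some power \<open>s\<^sup>k\<close> is congruent to 1 modulo
  \<open>n\<close>. Thus \<open>s\<^sup>k\<close> is trivial, hence 1 since its trace is
  positive, and then \<open>s = 1\<close> by positivity of \<open>x x*\<close>. Finally
  \<open>u u* = 1\<close> says that the squares of the coefficients of \<open>u\<close> sum to
  1.
\<close>

section \<open>Integral group rings\<close>

lemma lookup_frag_extend:
  "Poly_Mapping.lookup (frag_extend b f) z =
    (\<Sum>i \<in> Poly_Mapping.keys f. Poly_Mapping.lookup f i * Poly_Mapping.lookup (b i) z)"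
  by (simp add: frag_extend_def lookup_sum)

lemma frag_extend_fun_minus:
  "frag_extend (\<lambda>x. a x - b x) f = frag_extend a f - frag_extend b f"
  using frag_extend_fun_add[of "\<lambda>x. a x - b x" b f] by simp

lemma keys_frag_extend_subset:
  assumes "Poly_Mapping.keys f \<subseteq> A" and "\<And>x. x \<in> A \<Longrightarrow> Poly_Mapping.keys (b x) \<subseteq> B"
  shows "Poly_Mapping.keys (frag_extend b f) \<subseteq> B"
  using keys_frag_extend[of b f] assms by blast

lemma frag_cmul_eq_iff: "frag_cmul c f = frag_cmul c g \<longleftrightarrow> c = 0 \<or> f = g"
  by (metis frag_cmul_eq_0_iff frag_cmul_diff_distrib right_minus_eq diff_numeral_special(9)
      frag_cmul_zero lookup_frag_cmul mult_cancel_left poly_mapping_eqI)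

lemma frag_cmul_diff: "frag_cmul c (f - g) = frag_cmul c f - frag_cmul c g"
  by (rule poly_mapping_eqI) (simp add: lookup_minus right_diff_distrib)

lemma frag_cmul_uminus [simp]: "frag_cmul c (- f) = frag_cmul (- c) f"
  by (rule poly_mapping_eqI) simp

context group
begin

abbreviation ZG :: "('a \<Rightarrow>\<^sub>0 int) ring"
  where "ZG \<equiv> integral_group_ring G"

abbreviation conv :: "('a \<Rightarrow>\<^sub>0 int) \<Rightarrow> ('a \<Rightarrow>\<^sub>0 int) \<Rightarrow> 'a \<Rightarrow>\<^sub>0 int" (infixl "\<star>" 70)
  where "f \<star> g \<equiv> f \<otimes>\<^bsub>ZG\<^esub> g"

lemma ring_ZG: "ring ZG"
  by (simp add: ring_integral_group_ring is_group)

lemma monoid_ZG: "monoid ZG"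
  using ring_ZG by (simp add: ring_def)

lemma conv_def: "f \<star> g = frag_extend (\<lambda>x. frag_extend (\<lambda>y. frag_of (x \<otimes> y)) g) f"
  by (simp add: integral_group_ring_def)

lemma mem_ZG: "f \<in> carrier ZG \<longleftrightarrow> Poly_Mapping.keys f \<subseteq> carrier G"
  by (simp add: integral_group_ring_def)

lemma one_ZG [simp]: "\<one>\<^bsub>ZG\<^esub> = frag_of \<one>"
  by (simp add: integral_group_ring_def)

lemma ZG_closed [simp, intro]:
  "0 \<in> carrier ZG"
  "x \<in> carrier G \<Longrightarrow> frag_of x \<in> carrier ZG"
  "f \<in> carrier ZG \<Longrightarrow> - f \<in> carrier ZG"
  "f \<in> carrier ZG \<Longrightarrow> frag_cmul c f \<in> carrier ZG"
  "\<lbrakk>f \<in> carrier ZG; g \<in> carrier ZG\<rbrakk> \<Longrightarrow> f + g \<in> carrier ZG"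
  "\<lbrakk>f \<in> carrier ZG; g \<in> carrier ZG\<rbrakk> \<Longrightarrow> f - g \<in> carrier ZG"
  "\<lbrakk>f \<in> carrier ZG; g \<in> carrier ZG\<rbrakk> \<Longrightarrow> f \<star> g \<in> carrier ZG"
  using keys_add[of f g] keys_diff[of f g] keys_cmul[of c f] monoid.m_closed[OF monoid_ZG, of f g]
  by (auto simp: mem_ZG)

text \<open>Basis elements generate \<open>carrier ZG\<close> under subtraction, so an identity
  additive in \<open>f\<close> need only be checked on \<open>frag_of x\<close>.\<close>

lemma ZG_induct [consumes 1, case_names zero of diff]:
  assumes "f \<in> carrier ZG" and "P 0" and "\<And>x. x \<in> carrier G \<Longrightarrow> P (frag_of x)"
    and "\<And>f g. P f \<Longrightarrow> P g \<Longrightarrow> P (f - g)"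
  shows "P f"
  using frag_induction[of f "carrier G" P] assms by (simp add: mem_ZG)

lemma conv_bilinear [simp]:
  "0 \<star> f = 0" "f \<star> 0 = 0" "(- f) \<star> g = - (f \<star> g)" "f \<star> (- g) = - (f \<star> g)"
  "frag_cmul c f \<star> g = frag_cmul c (f \<star> g)" "f \<star> frag_cmul c g = frag_cmul c (f \<star> g)"
  "frag_of x \<star> frag_of y = frag_of (x \<otimes> y)"
proof -
  show "f \<star> 0 = 0"
    by (simp add: conv_def frag_extend_eq_0)
  show cmul: "f \<star> frag_cmul c g = frag_cmul c (f \<star> g)" for c
    by (simp add: conv_def frag_extend_cmul frag_extend_fun_cmul)
  show "f \<star> (- g) = - (f \<star> g)"
    using cmul[of "-1"] by simp
qed (simp_all add: conv_def frag_extend_minus frag_extend_cmul)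

lemma conv_distrib:
  "(f + g) \<star> h = f \<star> h + g \<star> h" "h \<star> (f + g) = h \<star> f + h \<star> g"
  "(f - g) \<star> h = f \<star> h - g \<star> h" "h \<star> (f - g) = h \<star> f - h \<star> g"
  by (simp_all add: conv_def frag_extend_add frag_extend_diff frag_extend_fun_add
      frag_extend_fun_minus)

lemma conv_assoc:
  "\<lbrakk>f \<in> carrier ZG; g \<in> carrier ZG; h \<in> carrier ZG\<rbrakk> \<Longrightarrow> f \<star> g \<star> h = f \<star> (g \<star> h)"
  by (rule monoid.m_assoc[OF monoid_ZG])

lemma conv_one [simp]:
  "f \<in> carrier ZG \<Longrightarrow> frag_of \<one> \<star> f = f" "f \<in> carrier ZG \<Longrightarrow> f \<star> frag_of \<one> = f"
  using monoid.l_one[OF monoid_ZG, of f] monoid.r_one[OF monoid_ZG, of f] by (simp_all add: one_ZG)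

lemma keys_conv:
  "Poly_Mapping.keys (f \<star> g) \<subseteq> {x \<otimes> y |x y. x \<in> Poly_Mapping.keys f \<and> y \<in> Poly_Mapping.keys g}"
  unfolding conv_def by (rule keys_frag_extend_subset[OF order_refl])+ auto

subsection \<open>The involution\<close>

definition adj :: "('a \<Rightarrow>\<^sub>0 int) \<Rightarrow> 'a \<Rightarrow>\<^sub>0 int"
  where "adj = frag_extend (\<lambda>x. frag_of (inv x))"

text \<open>Together with \<open>adj\<close> this encodes the standard inner product: for
  \<open>f\<close> and \<open>g\<close> in \<open>carrier ZG\<close>,
  \<open>trace (f \<star> adj g)\<close> is the dot product of their coefficient vectors.\<close>

definition trace :: "('a \<Rightarrow>\<^sub>0 int) \<Rightarrow> int"
  where "trace f = Poly_Mapping.lookup f \<one>"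

lemma adj_simps [simp]:
  "adj 0 = 0" "adj (frag_of x) = frag_of (inv x)" "adj (f - g) = adj f - adj g"
  "adj (f + g) = adj f + adj g" "adj (- f) = - adj f"
  by (simp_all add: adj_def frag_extend_diff frag_extend_add frag_extend_minus)

lemma adj_closed [simp, intro]: "f \<in> carrier ZG \<Longrightarrow> adj f \<in> carrier ZG"
  unfolding adj_def mem_ZG by (erule keys_frag_extend_subset) simp

lemma keys_adj: "Poly_Mapping.keys (adj f) \<subseteq> m_inv G ` Poly_Mapping.keys f"
  unfolding adj_def by (rule keys_frag_extend_subset[OF order_refl]) simp

lemma adj_adj [simp]: "f \<in> carrier ZG \<Longrightarrow> adj (adj f) = f"
  by (induction f rule: ZG_induct) simp_all

lemma adj_conv: "\<lbrakk>f \<in> carrier ZG; g \<in> carrier ZG\<rbrakk> \<Longrightarrow> adj (f \<star> g) = adj g \<star> adj f"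
proof (induction f rule: ZG_induct)
  case (of x)
  from of(2) show ?case
    by (induction g rule: ZG_induct) (simp_all add: conv_distrib of inv_mult_group)
qed (simp_all add: conv_distrib)

lemma trace_simps [simp]:
  "trace 0 = 0" "trace (f + g) = trace f + trace g" "trace (f - g) = trace f - trace g"
  "trace (- f) = - trace f" "trace (frag_of x) = (if x = \<one> then 1 else 0)"
  by (simp_all add: trace_def lookup_add lookup_minus)

text \<open>\<open>x \<otimes> inv y\<close> is the identity only for \<open>x = y\<close>, so only
  the diagonal terms of the double sum contribute.\<close>

lemma trace_conv_adj:
  assumes "f \<in> carrier ZG"
  shows "trace (f \<star> adj f) = (\<Sum>x \<in> Poly_Mapping.keys f. (Poly_Mapping.lookup f x)\<^sup>2)"
proof -
  have "f \<star> adj f = frag_extend (\<lambda>x. frag_extend (\<lambda>y. frag_of (x \<otimes> inv y)) f) f"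
    by (simp add: conv_def adj_def Defs.frag_extend_compose)
  moreover have "\<one> = x \<otimes> inv y \<longleftrightarrow> x = y"
    if "x \<in> Poly_Mapping.keys f" "y \<in> Poly_Mapping.keys f" for x y
    using that assms inv_equality[of x "inv y"] by (auto simp: mem_ZG subset_iff)
  then have "(\<Sum>y \<in> Poly_Mapping.keys f. Poly_Mapping.lookup f y *
      Poly_Mapping.lookup (frag_of (x \<otimes> inv y)) \<one>) =
      (\<Sum>y \<in> Poly_Mapping.keys f. if x = y then Poly_Mapping.lookup f y else 0)"
    if "x \<in> Poly_Mapping.keys f" for x
    using that by (intro sum.cong) simp_all
  ultimately show ?thesis
    by (simp add: trace_def lookup_frag_extend power2_eq_square)
qed

lemma trace_conv_adj_nonneg: "f \<in> carrier ZG \<Longrightarrow> 0 \<le> trace (f \<star> adj f)"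
  by (simp add: trace_conv_adj sum_nonneg)

lemma trace_conv_adj_eq_0:
  assumes "f \<in> carrier ZG" and "trace (f \<star> adj f) \<le> 0"
  shows "f = 0"
proof -
  have "(\<Sum>x \<in> Poly_Mapping.keys f. (Poly_Mapping.lookup f x)\<^sup>2) = 0"
    using assms trace_conv_adj_nonneg[of f] by (simp add: trace_conv_adj)
  then have "\<forall>x \<in> Poly_Mapping.keys f. Poly_Mapping.lookup f x = 0"
    by (subst (asm) sum_nonneg_eq_0_iff) auto
  then have "Poly_Mapping.keys f = {}"
    unfolding in_keys_iff by blast
  then show ?thesis by simp
qed

lemma conv_adj_eq_0: "\<lbrakk>f \<in> carrier ZG; f \<star> adj f = 0\<rbrakk> \<Longrightarrow> f = 0"
  using trace_conv_adj_eq_0[of f] by simp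

text \<open>By integrality each coefficient in the support contributes at least 1 to the sum of
  squares, so there is a single one, and it is 1 or -1.\<close>

lemma trace_conv_adj_le_1:
  assumes "f \<in> carrier ZG" and "f \<noteq> 0" and "trace (f \<star> adj f) \<le> 1"
  obtains x where "x \<in> carrier G" "f = frag_of x \<or> f = - frag_of x"
proof -
  let ?c = "Poly_Mapping.lookup f"
  obtain x where x: "x \<in> Poly_Mapping.keys f"
    using assms(2) by (metis keys_eq_empty ex_in_conv)
  have pos: "1 \<le> (?c y)\<^sup>2" if "y \<in> Poly_Mapping.keys f" for y
  proof -
    have "?c y \<noteq> 0"
      using that by (simp add: in_keys_iff)
    then have "0 < (?c y)\<^sup>2" by simp
    then show ?thesis by linarith
  qed
  have sum: "(\<Sum>y \<in> Poly_Mapping.keys f. (?c y)\<^sup>2) \<le> 1"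
    using assms trace_conv_adj by simp
  have split: "(?c x)\<^sup>2 + (\<Sum>y \<in> Poly_Mapping.keys f - {x}. (?c y)\<^sup>2) \<le> 1"
    using sum x by (simp add: sum.remove[of _ x])
  have "(\<Sum>y \<in> Poly_Mapping.keys f - {x}. (1::int)) \<le> (\<Sum>y \<in> Poly_Mapping.keys f - {x}. (?c y)\<^sup>2)"
    by (rule sum_mono) (use pos in auto)
  then have "int (card (Poly_Mapping.keys f - {x})) = 0"
    using split pos[OF x] unfolding sum_constant by linarith
  then have "Poly_Mapping.keys f - {x} = {}"
    by (metis card_0_eq finite_Diff finite_keys of_nat_eq_0_iff)
  then have keys: "Poly_Mapping.keys f = {x}"
    using x by auto
  then have "(?c x)\<^sup>2 = 1"
    using split pos[OF x] by simp
  then have "?c x = 1 \<or> ?c x = -1"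
    by (simp add: power2_eq_1_iff)
  moreover have "f = frag_cmul (?c x) (frag_of x)"
    using keys frag_expansion[of f] by (simp add: frag_extend_def)
  ultimately have "f = frag_of x \<or> f = - frag_of x"
    by (metis frag_cmul_minus_one frag_cmul_one)
  then show thesis
    using that x assms(1) by (auto simp: mem_ZG)
qed

subsection \<open>The center\<close>

text \<open>The center of the whole ring is easier to handle than that of the unit group, being
  closed under sums and homogeneous components; \<open>center_units_ZG\<close> relates the
  two.\<close>

definition ZC :: "('a \<Rightarrow>\<^sub>0 int) set"
  where "ZC = {f \<in> carrier ZG. \<forall>h \<in> carrier ZG. f \<star> h = h \<star> f}"

lemma ZC_I:
  assumes "f \<in> carrier ZG" and "\<And>x. x \<in> carrier G \<Longrightarrow> f \<star> frag_of x = frag_of x \<star> f"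
  shows "f \<in> ZC"
proof -
  have "f \<star> h = h \<star> f" if "h \<in> carrier ZG" for h
    using that by (induction h rule: ZG_induct) (simp_all add: conv_distrib assms)
  then show ?thesis by (simp add: ZC_def assms)
qed

lemma ZC_D: "f \<in> ZC \<Longrightarrow> f \<in> carrier ZG" "\<lbrakk>f \<in> ZC; h \<in> carrier ZG\<rbrakk> \<Longrightarrow> f \<star> h = h \<star> f"
  by (simp_all add: ZC_def)

lemma ZC_closed [simp, intro]:
  assumes "f \<in> ZC" "g \<in> ZC"
  shows "f + g \<in> ZC" "f - g \<in> ZC" "f \<star> g \<in> ZC" "adj f \<in> ZC"
proof -
  show "f \<star> g \<in> ZC"
    unfolding ZC_def using assms
    by (auto intro: ZC_D) (metis ZC_D conv_assoc)
  show "adj f \<in> ZC"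
  proof (rule ZC_I)
    fix x assume "x \<in> carrier G"
    then have "adj (f \<star> frag_of (inv x)) = adj (frag_of (inv x) \<star> f)"
      using ZC_D(2)[OF assms(1), of "frag_of (inv x)"] by simp
    then show "adj f \<star> frag_of x = frag_of x \<star> adj f"
      using assms \<open>x \<in> carrier G\<close> by (simp add: adj_conv ZC_D)
  qed (simp add: assms ZC_D)
qed (use assms in \<open>auto simp: ZC_def conv_distrib\<close>)

lemma ZC_one [simp, intro]: "frag_of \<one> \<in> ZC"
  by (simp add: ZC_def)

text \<open>Compare the coefficients of \<open>f \<star> frag_of g\<close> and
  \<open>frag_of g \<star> f\<close> at \<open>g \<otimes> x\<close>. As supports are finite, their
  elements have finitely many conjugates.\<close>

lemma ZC_keys_conj:
  assumes "f \<in> ZC" and "x \<in> Poly_Mapping.keys f" and "g \<in> carrier G"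
  shows "g \<otimes> x \<otimes> inv g \<in> Poly_Mapping.keys f"
proof -
  have f: "f \<in> carrier ZG" using assms ZC_D by blast
  have x: "x \<in> carrier G" using assms f by (auto simp: mem_ZG)
  have shift: "Poly_Mapping.lookup (f \<star> frag_of g) (z \<otimes> g) = Poly_Mapping.lookup f z"
    "Poly_Mapping.lookup (frag_of g \<star> f) (g \<otimes> z) = Poly_Mapping.lookup f z"
    if z: "z \<in> carrier G" for z
    using f by (induction f rule: ZG_induct)
      (simp_all add: conv_distrib lookup_minus lookup_single when_def assms z)
  have "Poly_Mapping.lookup f (g \<otimes> x \<otimes> inv g) = Poly_Mapping.lookup (f \<star> frag_of g) (g \<otimes> x \<otimes> inv g \<otimes> g)"
    using shift(1)[of "g \<otimes> x \<otimes> inv g"] x assms by simp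
  also have "g \<otimes> x \<otimes> inv g \<otimes> g = g \<otimes> x"
    using x assms by (simp add: m_assoc)
  also have "f \<star> frag_of g = frag_of g \<star> f"
    using ZC_D(2)[OF assms(1), of "frag_of g"] assms by simp
  finally show ?thesis
    using shift(2)[OF x] assms by (simp add: in_keys_iff)
qed

text \<open>The norm \<open>f \<star> adj f\<close> is self-adjoint and, by commutativity, squares
  to 0. Positive definiteness then applies twice, to the norm and to \<open>f\<close>.\<close>

lemma ZC_reduced:
  assumes "f \<in> ZC" and "f \<star> f = 0"
  shows "f = 0"
proof -
  have c: "f \<in> carrier ZG" "adj f \<in> carrier ZG" and comm: "adj f \<star> f = f \<star> adj f"
    using assms ZC_D by auto
  have "(f \<star> adj f) \<star> adj (f \<star> adj f) = f \<star> (adj f \<star> f) \<star> adj f"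
    using c by (simp add: adj_conv conv_assoc)
  also have "\<dots> = f \<star> f \<star> (adj f \<star> adj f)"
    using c by (simp add: comm conv_assoc)
  finally have "f \<star> adj f = 0"
    using assms c conv_adj_eq_0[of "f \<star> adj f"] by simp
  then show ?thesis
    using c conv_adj_eq_0 by blast
qed

text \<open>A central idempotent is self-adjoint, so its trace is the sum of the squares of its
  coefficients, one of which is the trace itself.\<close>
lemma ZC_idempotent:
  assumes "e \<in> ZC" and "e \<star> e = e"
  shows "e = 0 \<or> e = frag_of \<one>"
proof -
  have c: "e \<in> carrier ZG" "adj e \<in> carrier ZG" and comm: "adj e \<star> e = e \<star> adj e"
    using assms ZC_D by auto
  have idem': "adj e \<star> adj e = adj e"
    using assms(2) c adj_conv by metis
  \<comment> \<open>In effect \<open>e\<close> times \<open>1 - adj e\<close>. Its norm contains the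
    factor \<open>e - e \<star> e\<close>, which is 0, so \<open>e\<close> equals the self-adjoint
    \<open>e \<star> adj e\<close>.\<close>
  let ?f = "e - e \<star> adj e"
  have mid: "adj e \<star> (e \<star> adj e) = e \<star> adj e"
    using c comm idem' by (metis conv_assoc)
  have "?f \<star> adj ?f = ?f \<star> (adj e - e \<star> adj e)"
    using c by (simp add: adj_conv)
  also have "\<dots> = 0"
    using c assms(2) mid idem' by (simp add: conv_distrib conv_assoc)
  finally have "?f = 0"
    using conv_adj_eq_0[of ?f] c by simp
  then have e: "e = e \<star> adj e" by simp
  let ?c = "Poly_Mapping.lookup e"
  have tr: "?c \<one> = (\<Sum>x \<in> Poly_Mapping.keys e. (?c x)\<^sup>2)"
    using trace_conv_adj[of e] e c by (simp add: trace_def)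
  show ?thesis
  proof (cases "e = 0")
    case False
    then have "trace (e \<star> adj e) \<noteq> 0"
      using trace_conv_adj_eq_0[of e] c by auto
    then have one: "\<one> \<in> Poly_Mapping.keys e"
      using e by (simp add: trace_def in_keys_iff)
    then have split: "?c \<one> = (?c \<one>)\<^sup>2 + (\<Sum>x \<in> Poly_Mapping.keys e - {\<one>}. (?c x)\<^sup>2)"
      using tr by (simp add: sum.remove[of _ \<one>])
    have "0 \<le> (\<Sum>x \<in> Poly_Mapping.keys e - {\<one>}. (?c x)\<^sup>2)"
      by (rule sum_nonneg) simp
    then have "(?c \<one>)\<^sup>2 \<le> ?c \<one>" using split by linarith
    then have "?c \<one> \<le> 1"
      by (rule contrapos_pp) (simp add: power2_eq_square)
    then have "trace (e \<star> adj e) \<le> 1"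
      using e by (simp add: trace_def)
    then obtain x where "e = frag_of x \<or> e = - frag_of x"
      using trace_conv_adj_le_1[of e] c False by auto
    \<comment> \<open>Positive trace excludes the minus sign and every \<open>x\<close> other than
      the identity.\<close>
    moreover have "trace e \<ge> 1"
      using e c trace_conv_adj_nonneg[of e] \<open>trace (e \<star> adj e) \<noteq> 0\<close> by simp
    ultimately show ?thesis
      by (auto split: if_splits)
  qed simp
qed


subsection \<open>Gradings by real-valued homomorphisms\<close>

definition real_hom :: "('a \<Rightarrow> real) \<Rightarrow> bool"
  where "real_hom \<phi> \<longleftrightarrow> (\<forall>x \<in> carrier G. \<forall>y \<in> carrier G. \<phi> (x \<otimes> y) = \<phi> x + \<phi> y)"

text \<open>The homogeneous component of degree \<open>c\<close> in the grading of the group ring by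
  \<open>\<phi>\<close>.\<close>

definition comp :: "('a \<Rightarrow> real) \<Rightarrow> real \<Rightarrow> ('a \<Rightarrow>\<^sub>0 int) \<Rightarrow> 'a \<Rightarrow>\<^sub>0 int"
  where "comp \<phi> c = frag_extend (\<lambda>x. if \<phi> x = c then frag_of x else 0)"

lemma lookup_comp:
  "Poly_Mapping.lookup (comp \<phi> c f) x = (if \<phi> x = c then Poly_Mapping.lookup f x else 0)"
proof -
  have "Poly_Mapping.lookup (comp \<phi> c f) x =
      (\<Sum>y \<in> Poly_Mapping.keys f. if y = x then (if \<phi> x = c then Poly_Mapping.lookup f x else 0) else 0)"
    unfolding comp_def lookup_frag_extend by (rule sum.cong) auto
  then show ?thesis
    by (auto simp: in_keys_iff)
qed

lemma keys_comp: "Poly_Mapping.keys (comp \<phi> c f) = {x \<in> Poly_Mapping.keys f. \<phi> x = c}"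
  by (auto simp: in_keys_iff lookup_comp split: if_splits)

lemma comp_closed [simp, intro]: "f \<in> carrier ZG \<Longrightarrow> comp \<phi> c f \<in> carrier ZG"
  by (auto simp: mem_ZG keys_comp)

lemma comp_eq_0_iff: "comp \<phi> c f = 0 \<longleftrightarrow> (\<forall>x \<in> Poly_Mapping.keys f. \<phi> x \<noteq> c)"
  using keys_eq_empty[of "comp \<phi> c f"] by (auto simp: keys_comp)

lemma comp_id: "(\<And>x. x \<in> Poly_Mapping.keys f \<Longrightarrow> \<phi> x = c) \<Longrightarrow> comp \<phi> c f = f"
  by (rule poly_mapping_eqI) (metis in_keys_iff lookup_comp)

text \<open>A component of a product sums over all ways to split the degree. The hypothesis
  \<open>sep\<close> leaves only the split into \<open>a\<close> and \<open>b\<close>, as happens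
  for two top degrees or for a homogeneous factor.\<close>

lemma comp_conv:
  assumes "real_hom \<phi>" "f \<in> carrier ZG" "g \<in> carrier ZG"
    and sep: "\<And>x y. \<lbrakk>x \<in> Poly_Mapping.keys f; y \<in> Poly_Mapping.keys g; \<phi> x + \<phi> y = a + b\<rbrakk>
      \<Longrightarrow> \<phi> x = a \<and> \<phi> y = b"
  shows "comp \<phi> (a + b) (f \<star> g) = comp \<phi> a f \<star> comp \<phi> b g"
proof -
  have "comp \<phi> (a + b) (f \<star> g) = frag_extend (\<lambda>x. frag_extend
      (\<lambda>y. if \<phi> (x \<otimes> y) = a + b then frag_of (x \<otimes> y) else 0) g) f"
    by (simp add: comp_def conv_def Defs.frag_extend_compose)
  also have "\<dots> = frag_extend (\<lambda>x. frag_extend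
      (\<lambda>y. if \<phi> x = a \<and> \<phi> y = b then frag_of (x \<otimes> y) else 0) g) f"
    using assms(1-3) sep
    by (intro frag_extend_eq) (auto simp: real_hom_def mem_ZG subset_iff)
  also have "\<dots> = comp \<phi> a f \<star> comp \<phi> b g"
    unfolding comp_def conv_def Defs.frag_extend_compose
    by (intro frag_extend_eq) (auto simp: frag_extend_eq_0 intro!: frag_extend_eq)
  finally show ?thesis .
qed

lemma comp_conv_homogeneous:
  assumes "real_hom \<phi>" "f \<in> carrier ZG" "g \<in> carrier ZG"
    and "\<And>x. x \<in> Poly_Mapping.keys f \<Longrightarrow> \<phi> x = a"
  shows "comp \<phi> (a + b) (f \<star> g) = f \<star> comp \<phi> b g" "comp \<phi> (b + a) (g \<star> f) = comp \<phi> b g \<star> f"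
  using comp_conv[of \<phi> f g a b] comp_conv[of \<phi> g f b a] comp_id[of f \<phi> a] assms by auto

text \<open>Multiplication by \<open>frag_of x\<close> on either side shifts every degree by
  \<open>\<phi> x\<close>, so commuting with \<open>frag_of x\<close> can be read off degree by
  degree.\<close>

lemma comp_ZC:
  assumes "real_hom \<phi>" "f \<in> ZC"
  shows "comp \<phi> c f \<in> ZC"
proof (rule ZC_I)
  have f: "f \<in> carrier ZG" using assms ZC_D by blast
  then show "comp \<phi> c f \<in> carrier ZG" by simp
  fix x assume x: "x \<in> carrier G"
  have "comp \<phi> c f \<star> frag_of x = comp \<phi> (c + \<phi> x) (f \<star> frag_of x)"
    using comp_conv_homogeneous(2)[of \<phi> "frag_of x" f "\<phi> x" c] f x assms by simp
  also have "f \<star> frag_of x = frag_of x \<star> f"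
    using ZC_D(2)[OF assms(2), of "frag_of x"] x by simp
  also have "comp \<phi> (c + \<phi> x) (frag_of x \<star> f) = frag_of x \<star> comp \<phi> c f"
    using comp_conv_homogeneous(1)[of \<phi> "frag_of x" f "\<phi> x" c] f x assms by (simp add: add.commute)
  finally show "comp \<phi> c f \<star> frag_of x = frag_of x \<star> comp \<phi> c f" .
qed

text \<open>Let \<open>p\<close> be the top component of \<open>u\<close>. The top component of \<open>p \<star> v\<close> turns out to be a nonzero
  central idempotent, hence 1, which leaves no room for terms of \<open>v\<close> of degree above
  minus the degree of \<open>p\<close>.\<close>
lemma ZC_unit_degree_le:
  assumes \<phi>: "real_hom \<phi>" and u: "u \<in> ZC" and v: "v \<in> ZC" and uv: "u \<star> v = frag_of \<one>"
    and a: "a \<in> Poly_Mapping.keys u" and b: "b \<in> Poly_Mapping.keys v"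
  shows "\<phi> a + \<phi> b \<le> 0"
proof -
  note [simp] = ZC_D(1)
  define c where "c = Max (\<phi> ` Poly_Mapping.keys u)"
  have u_le: "\<phi> x \<le> c" if "x \<in> Poly_Mapping.keys u" for x
    using that by (simp add: c_def)
  have "c \<in> \<phi> ` Poly_Mapping.keys u"
    unfolding c_def using a by (intro Max_in) auto
  then have p0: "comp \<phi> c u \<noteq> 0"
    by (auto simp: comp_eq_0_iff)
  define p where "p = comp \<phi> c u"
  have p: "p \<in> ZC" and p_deg: "\<And>x. x \<in> Poly_Mapping.keys p \<Longrightarrow> \<phi> x = c"
    using comp_ZC \<phi> u by (auto simp: p_def keys_comp)
  have vu: "v \<star> u = frag_of \<one>"
    using ZC_D(2)[OF v, of u] u uv by simp
  define w where "w = p \<star> v"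
  have w: "w \<in> ZC" using p v by (simp add: w_def)
  have wu: "w \<star> u = p"
    unfolding w_def using p u v by (simp add: conv_assoc vu)
  have "w \<noteq> 0" using wu p0 p_def by auto
  define d where "d = Max (\<phi> ` Poly_Mapping.keys w)"
  have w_le: "\<phi> x \<le> d" if "x \<in> Poly_Mapping.keys w" for x
    using that by (simp add: d_def)
  have "d \<in> \<phi> ` Poly_Mapping.keys w"
    unfolding d_def using \<open>w \<noteq> 0\<close> by (intro Max_in) auto
  then have e0: "comp \<phi> d w \<noteq> 0"
    by (auto simp: comp_eq_0_iff)
  define e where "e = comp \<phi> d w"
  define q where "q = comp \<phi> (d - c) v"
  have q: "q \<in> ZC" using comp_ZC \<phi> v by (simp add: q_def)
  have e: "e = p \<star> q"
    using comp_conv_homogeneous(1)[of \<phi> p v c "d - c"] \<phi> p v p_deg by (simp add: e_def w_def q_def)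
  have eC: "e \<in> ZC" using e p q by simp
  \<comment> \<open>The top parts of \<open>w\<close> and \<open>u\<close> multiply to the part of
    \<open>w \<star> u = p\<close> in degree \<open>d + c\<close>. Since \<open>p\<close> has degree
    \<open>c\<close>, this is \<open>p\<close> if \<open>d = 0\<close> and 0 otherwise.\<close>
  have ep: "e \<star> p = comp \<phi> (d + c) p"
  proof -
    have "comp \<phi> (d + c) (w \<star> u) = e \<star> p"
      unfolding e_def p_def
    proof (rule comp_conv)
      show "\<phi> x = d \<and> \<phi> y = c" if "x \<in> Poly_Mapping.keys w" "y \<in> Poly_Mapping.keys u"
        "\<phi> x + \<phi> y = d + c" for x y
        using w_le[OF that(1)] u_le[OF that(2)] that(3) by linarith
    qed (use \<phi> w u in auto)
    then show ?thesis by (simp add: wu)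
  qed
  have ee: "e \<star> e = e \<star> p \<star> q"
    using p q eC by (simp add: e conv_assoc)
  have "d = 0"
  proof (rule ccontr)
    assume "d \<noteq> 0"
    then have "e \<star> p = 0"
      using p_deg ep by (auto simp: comp_eq_0_iff)
    then show False
      using ZC_reduced[OF eC] ee e0 by (simp add: e_def)
  qed
  then have "e \<star> p = p"
    using ep comp_id[of p \<phi> c] p_deg by simp
  then have e1: "e = frag_of \<one>"
    using ZC_idempotent[OF eC] ee e e0 by (simp add: e_def)
  \<comment> \<open>Here \<open>q\<close> inverts \<open>p\<close>. Terms of \<open>q\<close> have
    degree \<open>d - c\<close> and those of \<open>w\<close> at most \<open>d\<close>, which is 0,
    so those of \<open>v\<close> have degree at most \<open>- c\<close>.\<close>
  have "v = q \<star> w"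
  proof -
    have "q \<star> w = p \<star> q \<star> v"
      unfolding w_def using p q v ZC_D(2)[OF q, of p] by (simp flip: conv_assoc)
    also have "p \<star> q = frag_of \<one>" using e e1 by simp
    finally show ?thesis using v by simp
  qed
  then have "b \<in> Poly_Mapping.keys (q \<star> w)"
    using b by simp
  then obtain x y where "b = x \<otimes> y" "x \<in> Poly_Mapping.keys q" "y \<in> Poly_Mapping.keys w"
    using keys_conv by blast
  moreover from this have "x \<in> carrier G" "y \<in> carrier G"
    using ZC_D(1)[OF q] ZC_D(1)[OF w] by (auto simp: mem_ZG)
  ultimately have "\<phi> b = \<phi> x + \<phi> y" "\<phi> x = d - c" "\<phi> y \<le> d"
    using \<phi> w_le by (auto simp: real_hom_def q_def keys_comp)
  then show ?thesis
    using \<open>d = 0\<close> u_le[OF a] by linarith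
qed

text \<open>The degree bound for \<open>\<phi>\<close> and for its negative gives
  \<open>\<phi> x + \<phi> y = 0\<close> for every \<open>x\<close> in the support of
  \<open>u\<close> and one fixed \<open>y\<close> in that of \<open>v\<close>.\<close>

lemma ZC_unit_homogeneous:
  assumes "real_hom \<phi>" "u \<in> ZC" "v \<in> ZC" "u \<star> v = frag_of \<one>"
    and "a \<in> Poly_Mapping.keys u" "b \<in> Poly_Mapping.keys u"
  shows "\<phi> a = \<phi> b"
proof -
  have "v \<noteq> 0" using assms(4) by auto
  then obtain y where y: "y \<in> Poly_Mapping.keys v"
    by (metis ex_in_conv keys_eq_empty)
  have neg: "real_hom (\<lambda>x. - \<phi> x)"
    using assms(1) by (simp add: real_hom_def)
  have "\<phi> x + \<phi> y = 0" if "x \<in> Poly_Mapping.keys u" for x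
    using ZC_unit_degree_le[OF assms(1-4) that y] ZC_unit_degree_le[OF neg assms(2-4) that y]
    by linarith
  from this[OF assms(5)] this[OF assms(6)] show ?thesis
    by linarith
qed

end

section \<open>Homomorphisms to the reals\<close>

text \<open>The homomorphism is the graph of a maximal subgroup of \<open>G \<times> \<real>\<close> that contains \<open>(a, 1)\<close>
  and meets \<open>{\<one>} \<times> \<real>\<close> trivially.\<close>
lemma (in comm_group) real_hom_of_infinite_order:
  assumes a: "a \<in> carrier G" and inf: "\<And>n::nat. n \<ge> 1 \<Longrightarrow> a [^] n \<noteq> \<one>"
  obtains \<psi> where "real_hom \<psi>" "\<psi> a = 1"
proof -
  define good where "good R \<longleftrightarrow> R \<subseteq> carrier G \<times> (UNIV :: real set) \<and> (a, 1) \<in> R \<and>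
      (\<forall>x r y s. (x, r) \<in> R \<longrightarrow> (y, s) \<in> R \<longrightarrow> (x \<otimes> y, r + s) \<in> R) \<and>
      (\<forall>x r. (x, r) \<in> R \<longrightarrow> (inv x, - r) \<in> R) \<and> (\<forall>r. (\<one>, r) \<in> R \<longrightarrow> r = 0)" for R
  have add: "(x \<otimes> y, r + s) \<in> R" if "good R" "(x, r) \<in> R" "(y, s) \<in> R" for R x r y s
    using that unfolding good_def by blast
  have minus: "(inv x, - r) \<in> R" if "good R" "(x, r) \<in> R" for R x r
    using that unfolding good_def by blast
  have one: "r = 0" if "good R" "(\<one>, r) \<in> R" for R r
    using that unfolding good_def by blast
  have carr: "x \<in> carrier G" if "good R" "(x, r) \<in> R" for R x r
    using that unfolding good_def by blast
  have zero: "(\<one>, 0) \<in> R" if "good R" for R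
    using add[OF that, of a 1 "inv a" "- 1"] minus[OF that, of a 1] that a
    by (simp add: good_def)
  have pow: "(x [^] (k::int), of_int k * r) \<in> R" if R: "good R" "(x, r) \<in> R" for R x r k
  proof -
    have nat: "(x [^] n, of_nat n * r) \<in> R" for n :: nat
    proof (induction n)
      case (Suc n)
      then show ?case
        using add[OF R(1) Suc R(2)] by (simp add: algebra_simps)
    qed (use zero[OF R(1)] in simp)
    show ?thesis
    proof (cases k rule: int_cases2)
      case (nonneg n)
      show ?thesis
        using nat[of n] unfolding nonneg int_pow_int by simp
    next
      case (nonpos n)
      show ?thesis
        using minus[OF R(1) nat[of n]] carr[OF R] unfolding nonpos
        by (simp add: int_pow_neg int_pow_int)
    qed
  qed
  \<comment> \<open>The cyclic subgroup generated by \<open>(a, 1)\<close>, the starting point for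
    Zorn's lemma. It satisfies the last condition of \<open>good\<close> because \<open>a\<close>
    has infinite order.\<close>
  define R0 where "R0 = range (\<lambda>k::int. (a [^] k, of_int k :: real))"
  have R0: "good R0"
    unfolding good_def
  proof (intro conjI allI impI)
    show "R0 \<subseteq> carrier G \<times> UNIV" using a by (auto simp: R0_def)
    show "(a, 1) \<in> R0"
      using a by (auto simp: R0_def image_iff intro!: exI[of _ "1::int"])
    show "(x \<otimes> y, r + s) \<in> R0" if "(x, r) \<in> R0" "(y, s) \<in> R0" for x r y s
    proof -
      obtain j k :: int where "x = a [^] j" "r = of_int j" "y = a [^] k" "s = of_int k"
        using \<open>(x, r) \<in> R0\<close> \<open>(y, s) \<in> R0\<close> by (auto simp: R0_def)
      then have "(x \<otimes> y, r + s) = (a [^] (j + k), of_int (j + k))"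
        using a by (simp add: int_pow_mult)
      then show ?thesis unfolding R0_def by (rule image_eqI) simp
    qed
    show "(inv x, - r) \<in> R0" if "(x, r) \<in> R0" for x r
    proof -
      obtain j :: int where "x = a [^] j" "r = of_int j"
        using \<open>(x, r) \<in> R0\<close> by (auto simp: R0_def)
      then have "(inv x, - r) = (a [^] (- j), of_int (- j))"
        using a by (simp add: int_pow_neg)
      then show ?thesis unfolding R0_def by (rule image_eqI) simp
    qed
    show "r = 0" if "(\<one>, r) \<in> R0" for r
    proof (rule ccontr)
      assume "r \<noteq> 0"
      from that obtain k :: int where k: "a [^] k = \<one>" "r = of_int k"
        by (auto simp: R0_def)
      have "a [^] nat \<bar>k\<bar> = \<one>"
      proof (cases k rule: int_cases2)
        case (nonneg n)
        then show ?thesis using k(1) by (simp add: int_pow_int)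
      next
        case (nonpos n)
        then show ?thesis using k(1) a by (simp add: int_pow_neg int_pow_int inv_eq_1_iff)
      qed
      moreover have "k \<noteq> 0" using k \<open>r \<noteq> 0\<close> by auto
      then have "nat \<bar>k\<bar> \<ge> 1" by linarith
      ultimately show False using inf by blast
    qed
  qed
  obtain R where R: "good R" and max: "\<And>R'. good R' \<Longrightarrow> R \<subseteq> R' \<Longrightarrow> R' = R"
  proof -
    have "\<exists>R \<in> Collect good. \<forall>R' \<in> Collect good. R \<subseteq> R' \<longrightarrow> R' = R"
    proof (rule subset_Zorn_nonempty)
      show "Collect good \<noteq> {}" using R0 by blast
      fix C assume C: "C \<noteq> {}" "subset.chain (Collect good) C"
      have mem: "good B" if "B \<in> C" for B
        using C(2) that by (auto simp: subset.chain_def)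
      have common: "\<exists>B \<in> C. p \<in> B \<and> q \<in> B" if "p \<in> \<Union> C" "q \<in> \<Union> C" for p q
        using C(2) that unfolding subset.chain_def by blast
      have "good (\<Union> C)"
        unfolding good_def
      proof (intro conjI allI impI)
        show "\<Union> C \<subseteq> carrier G \<times> UNIV" using mem unfolding good_def by blast
        show "(a, 1) \<in> \<Union> C" using mem C(1) unfolding good_def by blast
        show "(x \<otimes> y, r + s) \<in> \<Union> C" if "(x, r) \<in> \<Union> C" "(y, s) \<in> \<Union> C" for x r y s
          using common[OF that] add mem by blast
        show "(inv x, - r) \<in> \<Union> C" if "(x, r) \<in> \<Union> C" for x r
          using that minus mem by blast
        show "r = 0" if "(\<one>, r) \<in> \<Union> C" for r
          using that one mem by blast
      qed
      then show "\<Union> C \<in> Collect good" by simp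
    qed
    then show thesis using that by blast
  qed
  have total: "\<exists>r. (x, r) \<in> R" if x: "x \<in> carrier G" for x
  proof -
    \<comment> \<open>The value to be given to \<open>x\<close>. If a power of \<open>x\<close> with
      nonzero exponent already has a value, \<open>q\<close> is forced by division in the reals, and
      comparing two values of \<open>x [^] (j0 * j)\<close> shows consistency. Otherwise any real
      works, and 0 is taken.\<close>
    obtain q where q: "\<And>j::int. \<And>r. (x [^] j, r) \<in> R \<Longrightarrow> r = of_int j * q"
    proof (cases "\<exists>j::int. \<exists>r. j \<noteq> 0 \<and> (x [^] j, r) \<in> R")
      case True
      then obtain j0 :: int and r0 where j0: "j0 \<noteq> 0" "(x [^] j0, r0) \<in> R" by blast
      show thesis
      proof (rule that[of "r0 / of_int j0"])
        fix j :: int and r assume r: "(x [^] j, r) \<in> R"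
        have "(x [^] (j0 * j), of_int j * r0) \<in> R"
          using pow[OF R j0(2), of j] x by (simp add: int_pow_pow)
        moreover have "(x [^] (- (j0 * j)), - (of_int j0 * r)) \<in> R"
          using minus[OF R pow[OF R r, of j0]] x by (simp add: int_pow_pow int_pow_neg mult.commute)
        ultimately have "(\<one>, of_int j * r0 - of_int j0 * r) \<in> R"
          using add[OF R] x by (fastforce simp flip: int_pow_mult)
        then show "r = of_int j * (r0 / of_int j0)"
          using one[OF R, of "of_int j * r0 - of_int j0 * r"] j0(1) by (simp add: field_simps)
      qed
    next
      case False
      have "r = of_int j * 0" if "(x [^] j, r) \<in> R" for j :: int and r
        using False that one[OF R, of r] by (cases "j = 0") auto
      then show thesis using that by blast
    qed
    \<comment> \<open>The subgroup generated by \<open>R\<close> and \<open>(x, q)\<close>. The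
      property of \<open>q\<close> keeps it good, so maximality puts \<open>(x, q)\<close> into
      \<open>R\<close>.\<close>
    define R' where "R' = {(y \<otimes> x [^] j, r + of_int j * q) |y r (j::int). (y, r) \<in> R}"
    have sub: "R \<subseteq> R'"
    proof clarify
      fix y r assume "(y, r) \<in> R"
      then show "(y, r) \<in> R'"
        using carr[OF R] unfolding R'_def by (intro CollectI exI[of _ y] exI[of _ r] exI[of _ 0]) auto
    qed
    have "good R'"
      unfolding good_def
    proof (intro conjI allI impI)
      show "R' \<subseteq> carrier G \<times> UNIV" using carr[OF R] x by (auto simp: R'_def)
      show "(a, 1) \<in> R'" using sub R by (auto simp: good_def)
      show "(y \<otimes> z, r + s) \<in> R'" if yz: "(y, r) \<in> R'" "(z, s) \<in> R'" for y r z s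
      proof -
        obtain y' r' z' s' and j k :: int
          where yz': "(y', r') \<in> R" "(z', s') \<in> R" "y = y' \<otimes> x [^] j" "z = z' \<otimes> x [^] k"
            "r = r' + of_int j * q" "s = s' + of_int k * q"
          using yz unfolding R'_def by blast
        have "y \<otimes> z = (y' \<otimes> z') \<otimes> x [^] (j + k)"
          using yz' carr[OF R] x by (simp add: int_pow_mult m_ac)
        moreover have "r + s = (r' + s') + of_int (j + k) * q"
          using yz' by (simp add: algebra_simps)
        ultimately show ?thesis
          unfolding R'_def using add[OF R yz'(1,2)] by blast
      qed
      show "(inv y, - r) \<in> R'" if yr: "(y, r) \<in> R'" for y r
      proof -
        obtain y' r' and j :: int
          where y: "(y', r') \<in> R" "y = y' \<otimes> x [^] j" "r = r' + of_int j * q"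
          using yr unfolding R'_def by blast
        have "inv y = inv y' \<otimes> x [^] (- j)"
          using y carr[OF R] x by (simp add: int_pow_neg inv_mult)
        moreover have "- r = - r' + of_int (- j) * q"
          using y by simp
        ultimately show ?thesis
          unfolding R'_def using minus[OF R y(1)] by blast
      qed
      show "r = 0" if r: "(\<one>, r) \<in> R'" for r
      proof -
        obtain y' r' and j :: int
          where y: "(y', r') \<in> R" "\<one> = y' \<otimes> x [^] j" "r = r' + of_int j * q"
          using r unfolding R'_def by blast
        have "x [^] j = inv y'"
          using y carr[OF R] x by (metis inv_equality int_pow_closed inv_inv inv_closed inv_unique' m_comm)
        then have "- r' = of_int j * q"
          using minus[OF R y(1)] q by simp
        then show ?thesis using y(3) by simp
      qed
    qed
    then have "R' = R" using max sub by blast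
    moreover have "(x, q) \<in> R'"
      unfolding R'_def using zero[OF R] x
      by (intro CollectI exI[of _ "\<one>"] exI[of _ 0] exI[of _ 1]) auto
    ultimately show ?thesis by blast
  qed
  define \<psi> where "\<psi> x = (SOME r. (x, r) \<in> R)" for x
  have \<psi>: "(x, \<psi> x) \<in> R" if "x \<in> carrier G" for x
    unfolding \<psi>_def using total[OF that] by (rule someI_ex)
  have unique: "r = s" if "(x, r) \<in> R" "(x, s) \<in> R" for x r s
    using one[OF R, of "r - s"] add[OF R that(1) minus[OF R that(2)]] carr[OF R that(1)] by simp
  show thesis
  proof (rule that)
    show "real_hom \<psi>"
      unfolding real_hom_def using unique \<psi> add[OF R] by (meson m_closed)
    show "\<psi> a = 1"
      using unique[OF \<psi>[OF a]] R by (simp add: good_def)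
  qed
qed

context group
begin

text \<open>Transfer to a central subgroup of finite index, normalised so as to extend \<open>\<psi>\<close>.\<close>
lemma real_hom_extend_central:
  assumes K: "subgroup K G" and central: "\<And>k x. k \<in> K \<Longrightarrow> x \<in> carrier G \<Longrightarrow> k \<otimes> x = x \<otimes> k"
    and fin: "finite (rcosets K)"
    and \<psi>: "\<And>x y. x \<in> K \<Longrightarrow> y \<in> K \<Longrightarrow> \<psi> (x \<otimes> y) = \<psi> x + (\<psi> y :: real)"
  obtains \<phi> where "real_hom \<phi>" "\<And>k. k \<in> K \<Longrightarrow> \<phi> k = \<psi> k"
proof -
  interpret K: subgroup K G by fact
  define rep where "rep q = (SOME x. x \<in> q)" for q :: "'a set"
  have rep: "rep (K #> x) \<in> K #> x" if "x \<in> carrier G" for x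
    unfolding rep_def using rcos_self[OF that K] by (rule someI)
  have rep_carr: "rep (K #> x) \<in> carrier G" if "x \<in> carrier G" for x
    using rep[OF that] r_coset_subset_G[OF K.subset that] by blast
  \<comment> \<open>\<open>\<psi>\<close> is evaluated on the part of \<open>x\<close> in
    \<open>K\<close> relative to the chosen coset representative. Additivity is available for left
    factors from \<open>K\<close>.\<close>
  define f where "f x = \<psi> (x \<otimes> inv rep (K #> x))" for x
  have repK: "x \<otimes> inv rep (K #> x) \<in> K" if x: "x \<in> carrier G" for x
  proof -
    obtain k where k: "k \<in> K" "rep (K #> x) = k \<otimes> x"
      using rep[OF x] by (auto simp: r_coset_def)
    then have "x \<otimes> inv rep (K #> x) = inv k"
      using x by (simp add: inv_mult_group m_assoc[symmetric])
    then show ?thesis using k by simp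
  qed
  have f_left: "f (k \<otimes> x) = \<psi> k + f x" if "k \<in> K" "x \<in> carrier G" for k x
  proof -
    have "K #> (k \<otimes> x) = K #> x"
      using that K by (metis K.mem_carrier K.subset coset_mult_assoc coset_join2)
    then have "f (k \<otimes> x) = \<psi> (k \<otimes> (x \<otimes> inv rep (K #> x)))"
      using that rep_carr[OF that(2)] by (simp add: f_def m_assoc)
    then show ?thesis
      using \<psi>[OF that(1) repK[OF that(2)]] by (simp add: f_def)
  qed
  \<comment> \<open>The increment of \<open>f\<close> under right translation by \<open>h\<close>;
    left factors from \<open>K\<close> cancel, so it depends only on the coset.\<close>
  define D where "D h q = f (rep q \<otimes> h) - f (rep q)" for h q
  have D: "D h (K #> x) = f (x \<otimes> h) - f x" if xh: "x \<in> carrier G" "h \<in> carrier G" for x h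
  proof -
    obtain k where k: "k \<in> K" "rep (K #> x) = k \<otimes> x"
      using rep[OF xh(1)] by (auto simp: r_coset_def)
    then show ?thesis
      using f_left[of k x] f_left[of k "x \<otimes> h"] xh by (simp add: D_def m_assoc)
  qed
  let ?m = "real (card (rcosets K))"
  \<comment> \<open>Averaging instead of summing makes \<open>\<phi>\<close> agree with
    \<open>\<psi>\<close> on \<open>K\<close>: for central \<open>k\<close> each coset contributes
    \<open>\<psi> k\<close>.\<close>
  define \<phi> where "\<phi> h = (\<Sum>q \<in> rcosets K. D h q) / ?m" for h
  have ne: "?m \<noteq> 0"
    using fin rcosetsI[OF K.subset one_closed] by auto
  show thesis
  proof (rule that)
    show "real_hom \<phi>"
      unfolding real_hom_def
    proof (intro ballI)
      fix g h assume gh: "g \<in> carrier G" "h \<in> carrier G"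
      have "(\<Sum>q \<in> rcosets K. D (g \<otimes> h) q) = (\<Sum>q \<in> rcosets K. D g q + D h (q #> g))"
      proof (rule sum.cong)
        fix q assume "q \<in> rcosets K"
        then obtain x where "x \<in> carrier G" "q = K #> x" by (auto simp: RCOSETS_def)
        then show "D (g \<otimes> h) q = D g q + D h (q #> g)"
          using gh K.subset by (simp add: D coset_mult_assoc m_assoc)
      qed simp
      \<comment> \<open>Right multiplication by \<open>g\<close> permutes the cosets.\<close>
      moreover have "(\<Sum>q \<in> rcosets K. D h (q #> g)) = (\<Sum>q \<in> rcosets K. D h q)"
        by (rule sum.reindex_bij_witness[of _ "\<lambda>q. q #> inv g" "\<lambda>q. q #> g"])
          (use gh K.subset in \<open>auto simp: RCOSETS_def coset_mult_assoc m_assoc\<close>)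
      ultimately show "\<phi> (g \<otimes> h) = \<phi> g + \<phi> h"
        by (simp add: \<phi>_def sum.distrib add_divide_distrib)
    qed
    fix k assume k: "k \<in> K"
    have "D k q = \<psi> k" if q: "q \<in> rcosets K" for q
    proof -
      obtain x where x: "x \<in> carrier G" "q = K #> x"
        using q by (auto simp: RCOSETS_def)
      then show ?thesis
        using k f_left[OF k x(1)] central[OF k x(1)] by (simp add: D)
    qed
    then show "\<phi> k = \<psi> k"
      using ne by (simp add: \<phi>_def)
  qed
qed

end

section \<open>Torsion\<close>

context group
begin

definition centralizer :: "'a set \<Rightarrow> 'a set"
  where "centralizer A = {x \<in> carrier G. \<forall>a \<in> A. x \<otimes> a = a \<otimes> x}"

lemma subgroup_centralizer:
  assumes "A \<subseteq> carrier G"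
  shows "subgroup (centralizer A) G"
proof (rule subgroupI)
  show "centralizer A \<noteq> {}"
    using assms by (auto simp: centralizer_def intro!: exI[of _ "\<one>"])
  fix x assume x: "x \<in> centralizer A"
  show "inv x \<in> centralizer A"
  proof -
    have "inv x \<otimes> a = a \<otimes> inv x" if "a \<in> A" for a
    proof -
      have c: "x \<in> carrier G" "a \<in> carrier G" "x \<otimes> a = a \<otimes> x"
        using x assms that by (auto simp: centralizer_def)
      then have "inv x \<otimes> a = inv x \<otimes> (a \<otimes> x) \<otimes> inv x"
        by (simp add: m_assoc)
      also have "\<dots> = a \<otimes> inv x"
        using c by (simp flip: c(3) add: m_assoc[symmetric])
      finally show ?thesis .
    qed
    then show ?thesis using x by (simp add: centralizer_def)
  qed
  fix y assume y: "y \<in> centralizer A"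
  have "x \<otimes> y \<otimes> a = a \<otimes> (x \<otimes> y)" if "a \<in> A" for a
  proof -
    have c: "x \<in> carrier G" "y \<in> carrier G" "a \<in> carrier G" "x \<otimes> a = a \<otimes> x" "y \<otimes> a = a \<otimes> y"
      using x y assms that by (auto simp: centralizer_def)
    then show ?thesis by (metis m_assoc)
  qed
  then show "x \<otimes> y \<in> centralizer A"
    using x y by (simp add: centralizer_def)
qed (simp add: centralizer_def)

text \<open>Inside the double centralizer of the supports, the elements commuting with the supports form
  a central subgroup of finite index. A quotient \<open>a \<otimes> inv b\<close> of infinite order would have a nonzero image
  under some real-valued homomorphism of the double centralizer.\<close>
lemma ZC_unit_keys_torsion:
  assumes u: "u \<in> ZC" and v: "v \<in> ZC" and uv: "u \<star> v = frag_of \<one>"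
    and a: "a \<in> Poly_Mapping.keys u" and b: "b \<in> Poly_Mapping.keys u"
  shows "\<exists>n\<ge>1. (a \<otimes> inv b) [^] (n::nat) = \<one>"
proof (rule ccontr)
  assume no: "\<not> ?thesis"
  define S where "S = Poly_Mapping.keys u \<union> Poly_Mapping.keys v"
  have S: "S \<subseteq> carrier G" and fin: "finite S"
    using ZC_D(1)[OF u] ZC_D(1)[OF v] by (auto simp: S_def mem_ZG)
  have conj: "g \<otimes> s \<otimes> inv g \<in> S" if "s \<in> S" "g \<in> carrier G" for g s
    using that ZC_keys_conj u v by (auto simp: S_def)
  \<comment> \<open>Elements of \<open>S\<close> commute with \<open>centralizer S\<close>, hence
    lie in \<open>H\<close>; and all of \<open>H\<close> commutes with \<open>centralizer S\<close>,
    so \<open>K\<close> is central in \<open>H\<close>.\<close>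
  define H where "H = centralizer (centralizer S)"
  define K where "K = H \<inter> centralizer S"
  have subH: "subgroup H G" and subC: "subgroup (centralizer S) G"
    using S unfolding H_def by (auto intro!: subgroup_centralizer) (simp add: centralizer_def)
  have subK: "subgroup K G"
    unfolding K_def by (rule subgroups_Inter_pair[OF subH subC])
  interpret H: subgroup H G by fact
  interpret K: subgroup K G by fact
  let ?H = "G\<lparr>carrier := H\<rparr>"
  interpret GH: group ?H
    by (rule subgroup_imp_group[OF subH])
  have KH: "subgroup K ?H"
    using subK subH by (rule subgroup_incl) (simp add: K_def)
  have central: "k \<otimes> x = x \<otimes> k" if "k \<in> K" "x \<in> H" for k x
  proof -
    have "k \<in> centralizer S" using that(1) by (simp add: K_def)
    then have "x \<otimes> k = k \<otimes> x"
      using that(2) unfolding H_def centralizer_def[of "centralizer S"] by blast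
    then show ?thesis by simp
  qed
  have SH: "S \<subseteq> H"
  proof
    fix s assume s: "s \<in> S"
    have "s \<otimes> c = c \<otimes> s" if "c \<in> centralizer S" for c
      using that s by (simp add: centralizer_def)
    then show "s \<in> H"
      using s S unfolding H_def centralizer_def[of "centralizer S"] by blast
  qed
  have GH_conv: "f \<otimes>\<^bsub>integral_group_ring ?H\<^esub> g = f \<star> g" for f g
    by (simp add: integral_group_ring_def)
  have ZC_H: "f \<in> GH.ZC" if "f \<in> ZC" "Poly_Mapping.keys f \<subseteq> S" for f
  proof (rule GH.ZC_I)
    show "f \<in> carrier (integral_group_ring ?H)"
      using that SH by (auto simp: GH.mem_ZG)
    show "f \<otimes>\<^bsub>integral_group_ring ?H\<^esub> frag_of x = frag_of x \<otimes>\<^bsub>integral_group_ring ?H\<^esub> f"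
      if "x \<in> carrier ?H" for x
      unfolding GH_conv using ZC_D(2)[OF \<open>f \<in> ZC\<close>, of "frag_of x"] that by simp
  qed
  have uH: "u \<in> GH.ZC" and vH: "v \<in> GH.ZC"
    using ZC_H u v by (auto simp: S_def)
  \<comment> \<open>The conjugation action of \<open>h\<close> on \<open>S\<close>. Elements with
    equal actions lie in one coset of \<open>K\<close>, and a finite set has finitely many
    self-maps, so \<open>K\<close> has finite index in \<open>H\<close>.\<close>
  define c where "c h = (\<lambda>s \<in> S. h \<otimes> s \<otimes> inv h)" for h
  have c_eq: "inv y \<otimes> x \<in> K" if xy: "x \<in> H" "y \<in> H" "c x = c y" for x y
  proof -
    have "inv y \<otimes> x \<otimes> s = s \<otimes> (inv y \<otimes> x)" if "s \<in> S" for s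
    proof -
      have car: "x \<in> carrier G" "y \<in> carrier G" "s \<in> carrier G"
        using xy that S by auto
      have "x \<otimes> s \<otimes> inv x = y \<otimes> s \<otimes> inv y"
        using fun_cong[OF xy(3), of s] that by (simp add: c_def)
      then have "inv y \<otimes> (x \<otimes> s \<otimes> inv x) \<otimes> x = inv y \<otimes> (y \<otimes> s \<otimes> inv y) \<otimes> x"
        by simp
      moreover have "inv y \<otimes> (x \<otimes> s \<otimes> inv x) \<otimes> x = inv y \<otimes> x \<otimes> s"
        using car by (simp add: m_assoc)
      moreover have "inv y \<otimes> (y \<otimes> s \<otimes> inv y) \<otimes> x = s \<otimes> (inv y \<otimes> x)"
        using car by (simp add: m_assoc[symmetric])
      ultimately show ?thesis by simp
    qed
    moreover have "inv y \<otimes> x \<in> H" using xy(1,2) by simp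
    ultimately show ?thesis
      unfolding K_def centralizer_def[of S] using H.mem_carrier by blast
  qed
  have c_fin: "finite (c ` H)"
  proof (rule finite_subset)
    show "c ` H \<subseteq> S \<rightarrow>\<^sub>E S"
      unfolding c_def by (intro image_subsetI restrict_PiE_iff[THEN iffD2] ballI conj H.mem_carrier)
  qed (simp add: fin finite_PiE)
  have "finite (rcosets\<^bsub>?H\<^esub> K)"
  proof (rule finite_subset)
    show "rcosets\<^bsub>?H\<^esub> K \<subseteq> (\<lambda>f. K #>\<^bsub>?H\<^esub> inv_into H c f) ` c ` H"
    proof
      fix q assume "q \<in> rcosets\<^bsub>?H\<^esub> K"
      then obtain x where x: "x \<in> H" "q = K #>\<^bsub>?H\<^esub> x" by (auto simp: RCOSETS_def)
      let ?y = "inv_into H c (c x)"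
      have y: "?y \<in> H" "c ?y = c x"
        using x by (auto intro: inv_into_into f_inv_into_f)
      then have k: "inv ?y \<otimes> x \<in> K" (is "?k \<in> _")
        using c_eq x by simp
      have "x = ?y \<otimes> ?k"
        using x y by (simp add: m_assoc[symmetric])
      also have "\<dots> = ?k \<otimes> ?y"
        using central k y by simp
      finally have "x \<in> K #>\<^bsub>?H\<^esub> ?y"
        using k unfolding r_coset_def by auto
      then have "K #>\<^bsub>?H\<^esub> ?y = K #>\<^bsub>?H\<^esub> x"
        using GH.repr_independence[OF _ _ KH] y by simp
      then show "q \<in> (\<lambda>f. K #>\<^bsub>?H\<^esub> inv_into H c f) ` c ` H"
        using x by blast
    qed
  qed (simp add: c_fin)
  note fin_index = this
  define g where "g = a \<otimes> inv b"
  have abH: "a \<in> H" "b \<in> H" and gH: "g \<in> H"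
    using a b SH by (auto simp: g_def S_def)
  have powH: "g [^] n \<in> H" for n :: nat
    using gH by (induction n) auto
  \<comment> \<open>Finitely many actions force two powers of \<open>g\<close> to act alike, so some
    positive power of \<open>g\<close> lies in \<open>K\<close>.\<close>
  have "\<not> inj (\<lambda>n::nat. c (g [^] n))"
    using c_fin powH by (metis finite_imageD finite_subset image_subsetI imageI infinite_UNIV_nat)
  then obtain i j :: nat where ij: "i < j" "c (g [^] i) = c (g [^] j)"
    by (metis injI linorder_neqE_nat)
  define k where "k = j - i"
  have "g [^] j = g [^] i \<otimes> g [^] k"
    using ij gH by (simp add: k_def nat_pow_mult)
  then have "inv (g [^] i) \<otimes> g [^] j = g [^] k"
    using gH by (simp add: m_assoc[symmetric])
  then have zK: "g [^] k \<in> K"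
    using c_eq[OF powH powH, of j i] ij by simp
  define z where "z = g [^] k"
  have "k \<ge> 1" using ij by (simp add: k_def)
  let ?K = "G\<lparr>carrier := K\<rparr>"
  interpret GK: group ?K
    by (rule subgroup_imp_group[OF subK])
  interpret GK: comm_group ?K
    by (rule GK.group_comm_groupI) (use central in \<open>simp add: K_def\<close>)
  have "z [^]\<^bsub>?K\<^esub> n \<noteq> \<one>\<^bsub>?K\<^esub>" if "n \<ge> 1" for n :: nat
  proof -
    have "z [^]\<^bsub>?K\<^esub> n = g [^] (k * n)"
      using gH by (simp add: z_def nat_pow_pow flip: nat_pow_consistent)
    then show ?thesis
      using no that \<open>k \<ge> 1\<close> by (simp add: g_def)
  qed
  moreover have "z \<in> carrier ?K" using zK by (simp add: z_def)
  ultimately obtain \<psi> where \<psi>: "GK.real_hom \<psi>" "\<psi> z = 1"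
    using GK.real_hom_of_infinite_order by blast
  have \<psi>_add: "\<psi> (x \<otimes>\<^bsub>?H\<^esub> y) = \<psi> x + \<psi> y" if "x \<in> K" "y \<in> K" for x y
    using \<psi>(1) that by (simp add: GK.real_hom_def)
  have central': "k \<otimes>\<^bsub>?H\<^esub> x = x \<otimes>\<^bsub>?H\<^esub> k" if "k \<in> K" "x \<in> carrier ?H" for k x
    using central that by simp
  obtain \<phi> where \<phi>: "GH.real_hom \<phi>" "\<And>k. k \<in> K \<Longrightarrow> \<phi> k = \<psi> k"
    using GH.real_hom_extend_central[OF KH central' fin_index \<psi>_add] by blast
  have add: "\<phi> (x \<otimes> y) = \<phi> x + \<phi> y" if "x \<in> H" "y \<in> H" for x y
    using \<phi>(1) that by (simp add: GH.real_hom_def)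
  \<comment> \<open>Homogeneity of \<open>u\<close> gives \<open>\<phi> g = 0\<close>, while
    \<open>\<phi>\<close> extends \<open>\<psi>\<close> and \<open>\<psi>\<close> is 1 on a power of
    \<open>g\<close>.\<close>
  have "\<phi> a = \<phi> b"
    using GH.ZC_unit_homogeneous[OF \<phi>(1) uH vH _ a b] uv by (simp add: GH_conv)
  moreover have "\<phi> a = \<phi> g + \<phi> b"
    using add[of g b] gH abH by (simp add: g_def m_assoc)
  ultimately have "\<phi> g = 0" by simp
  have "\<phi> \<one> = 0"
    using add[of \<one> \<one>] by simp
  then have "\<phi> (g [^] n) = 0" for n :: nat
    by (induction n) (simp_all add: add powH gH \<open>\<phi> g = 0\<close>)
  then show False
    using \<phi>(2)[OF zK] \<psi>(2) by (simp add: z_def)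
qed

text \<open>Dietzmann's lemma. In a word of length more than \<open>card D * m\<close>, where \<open>m\<close> is a common exponent,
  some letter occurs \<open>m\<close> times; moving these occurrences to the front only conjugates the other
  letters, and then they cancel.\<close>
lemma finite_generate_normal_torsion:
  assumes D: "D \<subseteq> carrier G" "finite D"
    and conj: "\<And>g x. g \<in> carrier G \<Longrightarrow> x \<in> D \<Longrightarrow> g \<otimes> x \<otimes> inv g \<in> D"
    and torsion: "\<And>x. x \<in> D \<Longrightarrow> \<exists>n\<ge>1. x [^] (n::nat) = \<one>"
  shows "finite (generate G D)"
proof -
  obtain N where N: "\<And>x. x \<in> D \<Longrightarrow> N x \<ge> 1 \<and> x [^] (N x :: nat) = \<one>"
    using torsion by metis
  define m where "m = (\<Prod>x \<in> D. N x)"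
  have "N x \<noteq> 0" if "x \<in> D" for x
    using N[OF that] by simp
  then have m: "m \<ge> 1"
    using D(2) by (simp add: m_def Suc_le_eq)
  have exp: "x [^] m = \<one>" if x: "x \<in> D" for x
  proof -
    obtain k where "m = N x * k"
      using dvd_prodI[OF D(2) x, of N] by (auto simp: m_def)
    then show ?thesis
      using N[OF x] D(1) x nat_pow_pow[of x "N x" k] by auto
  qed
  define W where "W xs = foldr (\<otimes>) xs \<one>" for xs
  have W_simps [simp]: "W [] = \<one>" "W (x # xs) = x \<otimes> W xs" for x xs
    by (simp_all add: W_def)
  have W_closed: "W xs \<in> carrier G" if "set xs \<subseteq> D" for xs
    using that D(1) by (induction xs) auto
  have W_append: "W (xs @ ys) = W xs \<otimes> W ys" if "set xs \<subseteq> D" "set ys \<subseteq> D" for xs ys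
    using that D(1) by (induction xs) (auto simp: W_closed m_assoc)
  \<comment> \<open>\<open>inv x\<close> plays the role of \<open>g\<close> in \<open>conj\<close>,
    whence the double inverse; normality of \<open>D\<close> keeps the new letters in
    \<open>D\<close>.\<close>
  have W_conj: "W xs \<otimes> x = x \<otimes> W (map (\<lambda>y. inv x \<otimes> y \<otimes> inv (inv x)) xs)"
    if "x \<in> D" "set xs \<subseteq> D" for x xs
    using that(2)
  proof (induction xs)
    case Nil
    then show ?case using that(1) D(1) by auto
  next
    case (Cons y ys)
    let ?f = "\<lambda>y. inv x \<otimes> y \<otimes> inv (inv x)"
    have c: "x \<in> carrier G" "y \<in> carrier G" "W ys \<in> carrier G"
      using that(1) Cons.prems D(1) W_closed by auto
    have "set (map ?f ys) \<subseteq> D"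
      using conj[of "inv x"] Cons.prems c by auto
    then have c': "W (map ?f ys) \<in> carrier G" by (rule W_closed)
    have "W (y # ys) \<otimes> x = y \<otimes> (x \<otimes> W (map ?f ys))"
      using Cons c by (simp add: m_assoc)
    also have "\<dots> = x \<otimes> (?f y \<otimes> W (map ?f ys))"
      using c c' by (simp add: m_assoc[symmetric])
    finally show ?case by simp
  qed
  have move: "\<exists>ys. set ys \<subseteq> D \<and> length xs = length ys + j \<and> W xs = x [^] j \<otimes> W ys"
    if "x \<in> D" "set xs \<subseteq> D" "j \<le> count_list xs x" for x xs j
    using that(2,3)
  proof (induction j arbitrary: xs)
    case 0
    then show ?case using W_closed by (intro exI[of _ xs]) simp
  next
    case (Suc j)
    then have "x \<in> set xs"
      by (metis count_notin not_less_eq_eq zero_le)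
    \<comment> \<open>With the split at the first occurrence, all other copies of \<open>x\<close>
      lie in \<open>B\<close>, which stays unconjugated.\<close>
    then obtain A B where xs: "xs = A @ x # B" "x \<notin> set A"
      by (metis split_list_first)
    let ?A = "map (\<lambda>y. inv x \<otimes> y \<otimes> inv (inv x)) A"
    have x: "x \<in> carrier G" using that(1) D(1) by blast
    have AB: "set (?A @ B) \<subseteq> D"
      using conj[of "inv x"] Suc.prems x by (auto simp: xs)
    have "j \<le> count_list (?A @ B) x"
      using Suc.prems xs by simp
    from Suc.IH[OF AB this] obtain ys where ys: "set ys \<subseteq> D" "length (?A @ B) = length ys + j"
      "W (?A @ B) = x [^] j \<otimes> W ys" by blast
    have "W xs = W A \<otimes> x \<otimes> W B"
      using Suc.prems W_append[of A "x # B"] W_closed[of A] W_closed[of B] x by (simp add: xs m_assoc)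
    also have "\<dots> = x \<otimes> W (?A @ B)"
      using W_conj[OF that(1), of A] W_append[of ?A B] W_closed[of ?A] W_closed[of B] AB Suc.prems x
      by (simp add: xs m_assoc)
    also have "\<dots> = x [^] Suc j \<otimes> W ys"
      using x W_closed[OF ys(1)] by (simp only: ys(3) nat_pow_Suc2 m_assoc nat_pow_closed)
    finally show ?case
      using ys xs by (intro exI[of _ ys]) simp
  qed
  have reduce: "\<exists>ys. set ys \<subseteq> D \<and> length ys \<le> card D * m \<and> W ys = W xs" if "set xs \<subseteq> D" for xs
    using that
  proof (induction xs rule: length_induct)
    case (1 xs)
    show ?case
    proof (cases "length xs \<le> card D * m")
      case False
      have "\<exists>x \<in> D. m \<le> count_list xs x"
      proof (rule ccontr)
        assume "\<not> ?thesis"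
        then have "(\<Sum>x \<in> D. count_list xs x) \<le> (\<Sum>x \<in> D. m)"
          by (intro sum_mono) auto
        then show False
          using False sum_count_set[OF 1(2) D(2)] by simp
      qed
      then obtain x where x: "x \<in> D" "m \<le> count_list xs x" by blast
      obtain ys where ys: "set ys \<subseteq> D" "length xs = length ys + m" "W xs = x [^] m \<otimes> W ys"
        using move[OF x(1) 1(2) x(2)] by blast
      then have "length ys < length xs" "W xs = W ys"
        using m exp[OF x(1)] W_closed[OF ys(1)] by auto
      then show ?thesis using 1(1) ys(1) by metis
    qed (use 1 in blast)
  qed
  have word: "\<exists>xs. set xs \<subseteq> D \<and> W xs = h" if "h \<in> generate G D" for h
    using that
  proof induction
    case one
    show ?case by (intro exI[of _ "[]"]) simp
  next
    case (incl h)
    then show ?case using D(1) by (intro exI[of _ "[h]"]) auto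
  next
    case (inv h)
    have h: "h \<in> carrier G" using inv D(1) by blast
    have rep: "W (replicate n h) = h [^] n" for n
      using h by (induction n) (simp_all only: replicate.simps W_simps nat_pow_Suc2 nat_pow_0)
    have "h [^] (m - 1) \<otimes> h = \<one>"
      using exp[OF inv] m nat_pow_Suc[of h "m - 1"] by simp
    \<comment> \<open>The common exponent turns an inverse into a nonnegative power, so words in the
      letters of \<open>D\<close> suffice.\<close>
    then have "inv h = h [^] (m - 1)"
      using h by (simp add: inv_equality)
    then show ?case
      using inv rep by (intro exI[of _ "replicate (m - 1) h"]) auto
  next
    case (eng h1 h2)
    then obtain xs ys where "set xs \<subseteq> D" "W xs = h1" "set ys \<subseteq> D" "W ys = h2" by blast
    then show ?case by (intro exI[of _ "xs @ ys"]) (simp add: W_append)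
  qed
  have "generate G D \<subseteq> W ` {xs. set xs \<subseteq> D \<and> length xs \<le> card D * m}"
  proof (intro subsetI)
    fix h assume "h \<in> generate G D"
    then obtain xs where "set xs \<subseteq> D" "W xs = h" using word by blast
    with reduce obtain ys where "set ys \<subseteq> D" "length ys \<le> card D * m" "h = W ys" by metis
    then show "h \<in> W ` {xs. set xs \<subseteq> D \<and> length xs \<le> card D * m}" by blast
  qed
  then show ?thesis
    by (rule finite_subset) (simp add: D(2) finite_lists_length_le)
qed

end

section \<open>Central units\<close>

context group
begin

text \<open>Group elements are units, so an element commuting with all units commutes with a basis.
  The inverse of a central unit is central: insert \<open>u \<star> v\<close> and move
  \<open>u\<close> past \<open>frag_of x\<close>.\<close>

lemma center_units_ZG:
  "u \<in> center (units_of ZG) \<longleftrightarrow> u \<in> ZC \<and> (\<exists>v \<in> ZC. u \<star> v = frag_of \<one>)"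
proof
  assume u: "u \<in> center (units_of ZG)"
  then have "u \<in> Units ZG"
    by (simp add: center_def units_of_def)
  then obtain v where v: "u \<in> carrier ZG" "v \<in> carrier ZG" "v \<star> u = frag_of \<one>" "u \<star> v = frag_of \<one>"
    by (auto simp: Units_def one_ZG)
  have comm: "u \<star> frag_of x = frag_of x \<star> u" if x: "x \<in> carrier G" for x
  proof -
    have "frag_of x \<in> Units ZG"
      unfolding Units_def using x by (auto simp: one_ZG intro!: bexI[of _ "frag_of (inv x)"])
    then show ?thesis
      using u by (simp add: center_def units_of_def)
  qed
  have "v \<star> frag_of x = frag_of x \<star> v" if x: "x \<in> carrier G" for x
  proof -
    have "v \<star> frag_of x = v \<star> frag_of x \<star> (u \<star> v)"
      using v x by simp
    also have "\<dots> = v \<star> (frag_of x \<star> u) \<star> v"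
      using v(1,2) x by (simp add: conv_assoc)
    also have "\<dots> = v \<star> u \<star> (frag_of x \<star> v)"
      using v(1,2) x by (simp add: comm[OF x, symmetric] conv_assoc)
    finally show ?thesis using v x by simp
  qed
  then show "u \<in> ZC \<and> (\<exists>v \<in> ZC. u \<star> v = frag_of \<one>)"
    using v comm by (auto intro!: ZC_I)
next
  assume "u \<in> ZC \<and> (\<exists>v \<in> ZC. u \<star> v = frag_of \<one>)"
  then obtain v where uv: "u \<in> ZC" "v \<in> ZC" "u \<star> v = frag_of \<one>" by blast
  then have "v \<star> u = frag_of \<one>"
    using ZC_D(2)[OF uv(1), of v] ZC_D(1) by simp
  then have "u \<in> Units ZG"
    using uv ZC_D(1) by (auto simp: Units_def one_ZG)
  then show "u \<in> center (units_of ZG)"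
    using ZC_D(2)[OF uv(1)] by (auto simp: center_def units_of_def Units_def)
qed

lemma frag_of_ZC_iff: "x \<in> carrier G \<Longrightarrow> frag_of x \<in> ZC \<longleftrightarrow> x \<in> center G"
proof
  assume "x \<in> center G"
  then show "frag_of x \<in> ZC"
    by (auto simp: center_def intro!: ZC_I)
next
  assume x: "x \<in> carrier G" "frag_of x \<in> ZC"
  have "x \<otimes> y = y \<otimes> x" if "y \<in> carrier G" for y
    using ZC_D(2)[OF x(2), of "frag_of y"] that by (simp add: frag_of_eq)
  then show "x \<in> center G"
    using x by (simp add: center_def)
qed

lemma ZC_minus_iff: "- f \<in> ZC \<longleftrightarrow> f \<in> ZC"
proof -
  have "- f \<in> ZC" if "f \<in> ZC" for f
    using ZC_D[OF that] by (auto simp: ZC_def)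
  from this[of f] this[of "- f"] show ?thesis by auto
qed

lemma trivial_units_center:
  "frag_of ` center G \<union> (\<lambda>z. - frag_of z) ` center G \<subseteq> center (units_of ZG)"
proof -
  have "frag_of z \<in> center (units_of ZG) \<and> - frag_of z \<in> center (units_of ZG)"
    if z: "z \<in> center G" for z
  proof -
    \<comment> \<open>The center is the centralizer of the whole carrier, which is where closure
      under inverses comes from.\<close>
    have c: "z \<in> carrier G" "inv z \<in> centralizer (carrier G)" "frag_of z \<in> ZC"
      using z frag_of_ZC_iff[of z] subgroup.m_inv_closed[OF subgroup_centralizer[of "carrier G"], of z]
      by (auto simp: center_def centralizer_def)
    then have "frag_of (inv z) \<in> ZC"
      using frag_of_ZC_iff[of "inv z"] by (simp add: center_def centralizer_def)
    then have "\<exists>v \<in> ZC. frag_of z \<star> v = frag_of \<one>" "\<exists>v \<in> ZC. - frag_of z \<star> v = frag_of \<one>"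
      using c(1) by (auto simp: ZC_minus_iff intro: bexI[of _ "frag_of (inv z)"]
          bexI[of _ "- frag_of (inv z)"])
    then show ?thesis
      using c(3) by (simp add: center_units_ZG ZC_minus_iff)
  qed
  then show ?thesis by blast
qed

text \<open>Trivial units with central support are always central units. Conversely \<open>x\<close>
  need only be found in \<open>carrier G\<close>, since centrality of \<open>u\<close> makes it
  central.\<close>

lemma cut_group_iff:
  "cut_group G \<longleftrightarrow> (\<forall>u \<in> ZC. \<forall>v \<in> ZC. u \<star> v = frag_of \<one> \<longrightarrow>
    (\<exists>x \<in> carrier G. u = frag_of x \<or> u = - frag_of x))"
proof
  assume "cut_group G"
  then have "u \<in> frag_of ` center G \<union> (\<lambda>z. - frag_of z) ` center G"
    if "u \<in> ZC" "v \<in> ZC" "u \<star> v = frag_of \<one>" for u v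
    using that center_units_ZG[of u] by (auto simp: cut_group_def)
  then show "\<forall>u \<in> ZC. \<forall>v \<in> ZC. u \<star> v = frag_of \<one> \<longrightarrow>
      (\<exists>x \<in> carrier G. u = frag_of x \<or> u = - frag_of x)"
    by (fastforce simp: center_def)
next
  assume triv: "\<forall>u \<in> ZC. \<forall>v \<in> ZC. u \<star> v = frag_of \<one> \<longrightarrow>
    (\<exists>x \<in> carrier G. u = frag_of x \<or> u = - frag_of x)"
  have "u \<in> frag_of ` center G \<union> (\<lambda>z. - frag_of z) ` center G" if "u \<in> center (units_of ZG)" for u
  proof -
    have u: "u \<in> ZC" and "\<exists>v \<in> ZC. u \<star> v = frag_of \<one>"
      using that center_units_ZG by auto
    then obtain x where x: "x \<in> carrier G" "u = frag_of x \<or> u = - frag_of x"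
      using triv by blast
    then have "x \<in> center G"
      using u frag_of_ZC_iff[of x] ZC_minus_iff by auto
    then show ?thesis using x by blast
  qed
  then show "cut_group G"
    unfolding cut_group_def using trivial_units_center is_group by blast
qed

subsection \<open>Powers of norms\<close>

abbreviation zpow :: "('a \<Rightarrow>\<^sub>0 int) \<Rightarrow> nat \<Rightarrow> 'a \<Rightarrow>\<^sub>0 int" (infixr "\<up>" 75)
  where "f \<up> k \<equiv> f [^]\<^bsub>ZG\<^esub> k"

lemma zpow_simps [simp]: "f \<up> 0 = frag_of \<one>" "f \<up> Suc k = f \<up> k \<star> f"
  using monoid.nat_pow_Suc[OF monoid_ZG] monoid.nat_pow_0[OF monoid_ZG] by (simp_all add: one_ZG)

lemma zpow_ZC [simp, intro]: "f \<in> ZC \<Longrightarrow> f \<up> k \<in> ZC"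
  by (induction k) auto

lemma ZC_left_commute:
  assumes "f \<in> ZC" "g \<in> carrier ZG" "h \<in> carrier ZG"
  shows "g \<star> (f \<star> h) = f \<star> (g \<star> h)"
  using assms ZC_D(2)[OF assms(1,2)] ZC_D(1) by (simp flip: conv_assoc)

lemma ZC_conv_conv:
  assumes "f \<in> ZC" "g \<in> ZC" "f' \<in> ZC" "g' \<in> ZC"
  shows "(f \<star> g) \<star> (f' \<star> g') = (f \<star> f') \<star> (g \<star> g')"
  using assms ZC_D(1) ZC_left_commute[of f' g g'] by (simp add: conv_assoc)

text \<open>The norm is multiplicative on the center, because the center is commutative.\<close>

lemma ZC_norm_pow:
  assumes "u \<in> ZC"
  shows "(u \<star> adj u) \<up> k = u \<up> k \<star> adj (u \<up> k)"
proof (induction k)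
  case (Suc k)
  have "adj (u \<up> k \<star> u) = adj (u \<up> k) \<star> adj u"
    using assms adj_conv[of "u \<up> k" u] ZC_D[of "adj u"] ZC_D(1)[of u] ZC_D(1)[of "u \<up> k"] by simp
  then show ?case
    using Suc assms by (simp add: ZC_conv_conv)
qed simp

lemma zpow_inverse:
  assumes "s \<in> ZC" "v \<in> ZC" "s \<star> v = frag_of \<one>"
  shows "s \<up> k \<star> v \<up> k = frag_of \<one>"
proof (induction k)
  case (Suc k)
  then show ?case
    using ZC_conv_conv[of "s \<up> k" s "v \<up> k" v] assms by simp
qed simp

lemma trace_norm_pos:
  assumes "f \<in> carrier ZG" "f \<noteq> 0"
  shows "trace (f \<star> adj f) \<ge> 1"
  using trace_conv_adj_eq_0[of f] assms by force

text \<open>With \<open>d = s - 1\<close>, where \<open>s = u \<star> adj u\<close>, the quantity \<open>trace ((s \<up> k - 1) \<star> d)\<close> does not decrease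
  in \<open>k\<close>, since its increments are the norms \<open>trace ((u \<up> k \<star> d) \<star> adj (u \<up> k \<star> d))\<close>.\<close>
lemma ZC_norm_torsion:
  assumes u: "u \<in> ZC" and k: "k \<ge> 1" "(u \<star> adj u) \<up> k = frag_of \<one>"
  shows "u \<star> adj u = frag_of \<one>"
proof -
  define s where "s = u \<star> adj u"
  define d where "d = s - frag_of \<one>"
  have s: "s \<in> ZC" and d: "d \<in> ZC"
    using u by (simp_all add: s_def d_def)
  note [simp] = ZC_D(1)
  have "adj s = s"
    using u by (simp add: s_def adj_conv)
  then have adj_d: "adj d = d"
    by (simp add: d_def)
  have step: "trace ((s \<up> Suc j - frag_of \<one>) \<star> d) \<ge> trace ((s \<up> j - frag_of \<one>) \<star> d)" for j
  proof -
    have uj: "u \<up> j \<in> ZC" using u by simp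
    have "(u \<up> j \<star> d) \<star> adj (u \<up> j \<star> d) = (u \<up> j \<star> adj (u \<up> j)) \<star> (d \<star> d)"
      using uj d ZC_D(2)[OF d, of "adj (u \<up> j)"] by (simp add: adj_conv adj_d ZC_conv_conv)
    also have "u \<up> j \<star> adj (u \<up> j) = s \<up> j"
      using ZC_norm_pow[OF u] by (simp add: s_def)
    also have "s \<up> j \<star> (d \<star> d) = (s \<up> j \<star> d) \<star> d"
      using s d by (simp add: conv_assoc)
    also have "s \<up> j \<star> d = s \<up> Suc j - s \<up> j"
      using s by (simp add: d_def conv_distrib)
    finally have "trace ((s \<up> Suc j - s \<up> j) \<star> d) \<ge> 0"
      using trace_conv_adj_nonneg[of "u \<up> j \<star> d"] uj d by simp
    then show ?thesis
      by (simp add: conv_distrib)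
  qed
  have "trace ((s \<up> Suc j - frag_of \<one>) \<star> d) \<ge> trace (d \<star> adj d)" for j
  proof (induction j)
    case 0
    then show ?case using s \<open>adj s = s\<close> by (simp add: d_def)
  next
    case (Suc j)
    then show ?case using step[of "Suc j"] by linarith
  qed
  \<comment> \<open>At this index the left side vanishes, because \<open>s \<up> k\<close> is the
    identity.\<close>
  from this[of "k - 1"] have "trace (d \<star> adj d) \<le> 0"
    using k by (simp add: s_def)
  then have "d = 0"
    using trace_conv_adj_eq_0 d by simp
  then show ?thesis
    by (simp add: d_def s_def)
qed

text \<open>The powers of \<open>s\<close> take finitely many values modulo \<open>n\<close>.\<close>
lemma ZC_unit_pow_cong_1:
  assumes s: "s \<in> ZC" and v: "v \<in> ZC" and sv: "s \<star> v = frag_of \<one>"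
    and F: "subgroup F G" "finite F" "Poly_Mapping.keys s \<subseteq> F" and n: "n \<ge> (1::int)"
  obtains k y where "k \<ge> 1" "y \<in> ZC" "s \<up> k = frag_of \<one> + frag_cmul n y"
proof -
  note [simp] = ZC_D(1)
  have keys: "Poly_Mapping.keys (s \<up> k) \<subseteq> F" for k
  proof (induction k)
    case 0
    then show ?case using subgroup.one_closed[OF F(1)] by simp
  next
    case (Suc k)
    then show ?case
      using keys_conv[of "s \<up> k" s] F(3) subgroup.m_closed[OF F(1)] by fastforce
  qed
  \<comment> \<open>All powers of \<open>s\<close> are supported in \<open>F\<close>, so their
    coefficients modulo \<open>n\<close> range over a finite set of functions and two powers
    agree.\<close>
  define r where "r k = (\<lambda>x \<in> F. Poly_Mapping.lookup (s \<up> k) x mod n)" for k :: nat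
  have "range r \<subseteq> F \<rightarrow>\<^sub>E {0..<n}"
    using n by (auto simp: r_def)
  then have "finite (range r)"
    by (rule finite_subset) (simp add: F(2) finite_PiE)
  then have "\<not> inj r"
    using finite_imageD infinite_UNIV_nat by blast
  then obtain i j where ij: "i < j" "r i = r j"
    by (metis injI linorder_neqE_nat)
  define k where "k = j - i"
  have dvd: "n dvd Poly_Mapping.lookup (s \<up> j - s \<up> i) x" for x
  proof (cases "x \<in> F")
    case True
    then have "Poly_Mapping.lookup (s \<up> i) x mod n = Poly_Mapping.lookup (s \<up> j) x mod n"
      using fun_cong[OF ij(2), of x] by (simp add: r_def)
    then show ?thesis
      by (simp add: lookup_minus mod_eq_dvd_iff flip: eq_commute[of "_ mod n" "_ mod n"])
        (metis mod_eq_dvd_iff)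
  next
    case False
    then have "x \<notin> Poly_Mapping.keys (s \<up> i)" "x \<notin> Poly_Mapping.keys (s \<up> j)"
      using keys by blast+
    then show ?thesis
      by (simp add: lookup_minus in_keys_iff)
  qed
  \<comment> \<open>Exact division by \<open>n\<close>. Since \<open>n\<close> is nonzero it can be
    cancelled, so \<open>z\<close> inherits centrality.\<close>
  define z where "z = Poly_Mapping.map (\<lambda>c. c div n) (s \<up> j - s \<up> i)"
  have z: "frag_cmul n z = s \<up> j - s \<up> i"
    using dvd by (intro poly_mapping_eqI) (simp add: z_def map.rep_eq when_def)
  have zZG: "z \<in> carrier ZG"
  proof -
    have "Poly_Mapping.keys z \<subseteq> Poly_Mapping.keys (frag_cmul n z)"
      using n by auto
    then show ?thesis
      using ZC_D(1)[OF ZC_closed(2)[OF zpow_ZC[OF s] zpow_ZC[OF s]], of j i] z by (simp add: mem_ZG)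
  qed
  have zZC: "z \<in> ZC"
  proof (rule ZC_I[OF zZG])
    fix x assume "x \<in> carrier G"
    then have "frag_cmul n z \<star> frag_of x = frag_of x \<star> frag_cmul n z"
      unfolding z using s by (intro ZC_D(2)) auto
    then show "z \<star> frag_of x = frag_of x \<star> z"
      using n by (simp add: frag_cmul_eq_iff)
  qed
  have pow_add: "s \<up> j = s \<up> k \<star> s \<up> i"
    using monoid.nat_pow_mult[OF monoid_ZG, of s k i] s ij by (simp add: k_def)
  have vi: "s \<up> i \<star> v \<up> i = frag_of \<one>"
    by (rule zpow_inverse[OF s v sv])
  \<comment> \<open>Multiplying by \<open>v \<up> i\<close> cancels \<open>s \<up> i\<close>, so
    \<open>s \<up> k - frag_of \<one>\<close> is still a multiple of \<open>n\<close>.\<close>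
  have "frag_cmul n (z \<star> v \<up> i) = s \<up> k \<star> s \<up> i \<star> v \<up> i - s \<up> i \<star> v \<up> i"
    using z by (simp add: pow_add conv_distrib flip: conv_bilinear(5))
  also have "\<dots> = s \<up> k - frag_of \<one>"
    using s v by (simp add: conv_assoc vi)
  finally show thesis
    using that[of k "z \<star> v \<up> i"] ij zZC v by (simp add: k_def)
qed

end

section \<open>Lifting central units from a finite quotient\<close>

lemma (in group) conv_sum:
  "(\<Sum>i \<in> I. f i) \<star> g = (\<Sum>i \<in> I. f i \<star> g)" "g \<star> (\<Sum>i \<in> I. f i) = (\<Sum>i \<in> I. g \<star> f i)"
  by (induction I rule: infinite_finite_induct) (simp_all add: conv_distrib)

context normal
begin

text \<open>For finite \<open>H\<close> this multiplies a lift by the sum of the elements of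
  \<open>H\<close>, without choosing the lift. It is additive but in general not
  multiplicative.\<close>

definition inflate :: "('a set \<Rightarrow>\<^sub>0 int) \<Rightarrow> 'a \<Rightarrow>\<^sub>0 int"
  where "inflate = frag_extend (\<lambda>q. \<Sum>x \<in> q. frag_of x)"

definition project :: "('a \<Rightarrow>\<^sub>0 int) \<Rightarrow> 'a set \<Rightarrow>\<^sub>0 int"
  where "project = frag_extend (\<lambda>x. frag_of (H #> x))"

lemma inflate_simps [simp]:
  "inflate 0 = 0" "inflate (frag_of q) = (\<Sum>x \<in> q. frag_of x)"
  "inflate (f + g) = inflate f + inflate g" "inflate (f - g) = inflate f - inflate g"
  by (simp_all add: inflate_def frag_extend_add frag_extend_diff)

lemma project_simps [simp]:
  "project 0 = 0" "project (frag_of x) = frag_of (H #> x)"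
  "project (f + g) = project f + project g" "project (f - g) = project f - project g"
  "project (- f) = - project f"
  by (simp_all add: project_def frag_extend_add frag_extend_diff frag_extend_minus)

interpretation Q: group "G Mod H"
  by (rule factorgroup_is_group)

notation Q.conv (infixl "\<star>\<^sub>Q" 70)

lemma carrier_Q: "q \<in> carrier (G Mod H) \<longleftrightarrow> (\<exists>x \<in> carrier G. q = H #> x)"
  by (auto simp: FactGroup_def RCOSETS_def)

lemma mult_Q: "\<lbrakk>x \<in> carrier G; y \<in> carrier G\<rbrakk> \<Longrightarrow> (H #> x) \<otimes>\<^bsub>G Mod H\<^esub> (H #> y) = H #> (x \<otimes> y)"
  by (simp add: FactGroup_def rcos_sum)

lemma one_Q: "\<one>\<^bsub>G Mod H\<^esub> = H #> \<one>"
  using subset by (simp add: FactGroup_def)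

lemma coset_image:
  assumes "x \<in> carrier G" "y \<in> carrier G"
  shows "(\<lambda>z. z \<otimes> y) ` (H #> x) = H #> (x \<otimes> y)" "(\<lambda>z. x \<otimes> z) ` (H #> y) = H #> (x \<otimes> y)"
proof -
  have "(\<lambda>z. z \<otimes> y) ` (H #> x) = H #> x #> y"
    by (auto simp: r_coset_def)
  then show "(\<lambda>z. z \<otimes> y) ` (H #> x) = H #> (x \<otimes> y)"
    using assms subset by (simp add: coset_mult_assoc)
  have "(\<lambda>z. x \<otimes> z) ` (H #> y) = x <# (y <# H)"
    using assms coset_eq by (auto simp: l_coset_def)
  also have "\<dots> = H #> (x \<otimes> y)"
    using assms subset coset_eq by (simp add: lcos_m_assoc)
  finally show "(\<lambda>z. x \<otimes> z) ` (H #> y) = H #> (x \<otimes> y)" .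
qed

text \<open>\<open>inflate\<close> is a bimodule map over \<open>ZG\<close>, which acts on the
  quotient ring through \<open>project\<close>. Indeed, as \<open>H\<close> is normal, translation
  by \<open>x\<close> on either side maps a coset bijectively onto the product coset.\<close>

lemma inflate_conv:
  assumes "f \<in> carrier Q.ZG" "h \<in> carrier ZG"
  shows "inflate f \<star> h = inflate (f \<star>\<^sub>Q project h)" "h \<star> inflate f = inflate (project h \<star>\<^sub>Q f)"
proof -
  have coset: "inflate (frag_of q) \<star> h = inflate (frag_of q \<star>\<^sub>Q project h) \<and>
      h \<star> inflate (frag_of q) = inflate (project h \<star>\<^sub>Q frag_of q)"
    if q: "q \<in> carrier (G Mod H)" for q
    using assms(2)
  proof (induction h rule: ZG_induct)
    case (of x)
    obtain y where y: "y \<in> carrier G" "q = H #> y"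
      using q carrier_Q by blast
    then have sub: "q \<subseteq> carrier G"
      using r_coset_subset_G subset by blast
    have inj: "inj_on (\<lambda>z. z \<otimes> x) q" "inj_on (\<lambda>z. x \<otimes> z) q"
      using sub of r_cancel l_cancel by (meson inj_onI subsetD)+
    have "(\<Sum>z \<in> q. frag_of (z \<otimes> x)) = (\<Sum>z \<in> H #> (y \<otimes> x). frag_of z)"
      unfolding coset_image(1)[OF y(1) of, symmetric] y(2)[symmetric]
      by (simp add: sum.reindex[OF inj(1)])
    moreover have "(\<Sum>z \<in> q. frag_of (x \<otimes> z)) = (\<Sum>z \<in> H #> (x \<otimes> y). frag_of z)"
      unfolding coset_image(2)[OF of y(1), symmetric] y(2)[symmetric]
      by (simp add: sum.reindex[OF inj(2)])
    ultimately show ?case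
      unfolding project_simps Q.conv_bilinear inflate_simps conv_sum conv_bilinear
      by (simp only: y(2) mult_Q[OF y(1) of] mult_Q[OF of y(1)])
  qed (simp_all add: conv_distrib Q.conv_distrib)
  show "inflate f \<star> h = inflate (f \<star>\<^sub>Q project h)"
    using assms(1) by (induction f rule: Q.ZG_induct) (use coset in \<open>simp_all add: conv_distrib Q.conv_distrib\<close>)
  show "h \<star> inflate f = inflate (project h \<star>\<^sub>Q f)"
    using assms(1) by (induction f rule: Q.ZG_induct) (use coset in \<open>simp_all add: conv_distrib Q.conv_distrib\<close>)
qed

lemma project_closed: "h \<in> carrier ZG \<Longrightarrow> project h \<in> carrier Q.ZG"
proof (induction h rule: ZG_induct)
  case (of x)
  then have "H #> x \<in> carrier (G Mod H)"
    using carrier_Q by blast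
  then show ?case
    unfolding project_simps by (rule Q.ZG_closed)
qed simp_all

lemma inflate_closed:
  assumes "f \<in> carrier Q.ZG"
  shows "inflate f \<in> carrier ZG"
proof -
  have "Poly_Mapping.keys (\<Sum>x \<in> q. frag_of x) \<subseteq> carrier G" if "q \<in> carrier (G Mod H)" for q
  proof -
    have "q \<subseteq> carrier G"
      using that r_coset_subset_G[OF subset] by (auto simp: carrier_Q)
    then show ?thesis
      using keys_sum[of "\<lambda>x. frag_of x" q] by auto
  qed
  then show ?thesis
    using assms unfolding inflate_def mem_ZG Q.mem_ZG by (rule keys_frag_extend_subset[rotated])
qed

text \<open>Each of the \<open>card H\<close> elements of a coset projects to it. For infinite
  \<open>H\<close>, sums over cosets and \<open>card H\<close> default to 0, so both sides
  vanish.\<close>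

lemma project_inflate:
  assumes "f \<in> carrier Q.ZG"
  shows "project (inflate f) = frag_cmul (int (card H)) f"
  using assms
proof (induction f rule: Q.ZG_induct)
  case (of q)
  have const: "(\<Sum>x \<in> A. f) = frag_cmul (int (card A)) f" for A :: "'a set" and f :: "'a set \<Rightarrow>\<^sub>0 int"
    by (induction A rule: infinite_finite_induct) (simp_all add: frag_cmul_distrib)
  obtain y where y: "y \<in> carrier G" "q = H #> y"
    using of carrier_Q by blast
  have "H #> x = q" if "x \<in> q" for x
    using repr_independence[OF _ y(1) is_subgroup] that y(2) by blast
  moreover have "project (\<Sum>x \<in> A. frag_of x) = (\<Sum>x \<in> A. frag_of (H #> x))" for A
    by (induction A rule: infinite_finite_induct) simp_all
  ultimately have "project (inflate (frag_of q)) = (\<Sum>x \<in> q. frag_of q)"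
    by simp
  also have "\<dots> = frag_cmul (int (card q)) (frag_of q)"
    by (rule const)
  also have "card q = card H"
    using card_rcosets_equal[of q H] y subset by (force simp: RCOSETS_def)
  finally show ?case .
qed (simp_all add: frag_cmul_diff)

text \<open>The lift is \<open>frag_of \<one> + inflate y\<close>, with inverse
  \<open>frag_of \<one> + inflate y'\<close>: expanding \<open>inverse\<close> and cancelling
  \<open>card H\<close> gives a relation whose inflation says that their product is the
  identity.\<close>

lemma cut_group_lift_unit:
  assumes cut: "cut_group G" and fin: "finite H"
    and y: "y \<in> Q.ZC" "y' \<in> Q.ZC"
    and inverse: "(frag_of \<one>\<^bsub>G Mod H\<^esub> + frag_cmul (int (card H)) y) \<star>\<^sub>Q
      (frag_of \<one>\<^bsub>G Mod H\<^esub> + frag_cmul (int (card H)) y') = frag_of \<one>\<^bsub>G Mod H\<^esub>"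
  obtains q where "q \<in> carrier (G Mod H)"
    "frag_of \<one>\<^bsub>G Mod H\<^esub> + frag_cmul (int (card H)) y = frag_of q \<or>
     frag_of \<one>\<^bsub>G Mod H\<^esub> + frag_cmul (int (card H)) y = - frag_of q"
proof -
  let ?n = "int (card H)" and ?e = "frag_of \<one>\<^bsub>G Mod H\<^esub>"
  note [simp] = Q.ZC_D(1) inflate_closed project_closed and [simp del] = one_FactGroup mult_FactGroup
  have n: "?n \<noteq> 0"
    using fin subgroup.one_closed[OF is_subgroup]
    by (metis card_eq_0_iff empty_iff of_nat_eq_0_iff)
  have inflate_ZC: "frag_of \<one> + inflate f \<in> ZC" if "f \<in> Q.ZC" for f
    unfolding ZC_def using that Q.ZC_D(2)[OF that]
    by (auto simp: conv_distrib inflate_conv)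
  let ?s = "y + y' + frag_cmul ?n (y \<star>\<^sub>Q y')"
  have "frag_cmul ?n ?s = 0"
  proof -
    have "?e + frag_cmul ?n ?s = ?e"
      using inverse y by (simp add: Q.conv_distrib frag_cmul_distrib2 algebra_simps)
    then show ?thesis by simp
  qed
  then have s: "?s = 0"
    using n by simp
  have "(frag_of \<one> + inflate y) \<star> (frag_of \<one> + inflate y') =
      frag_of \<one> + (inflate y + inflate y' + inflate y \<star> inflate y')"
    using y by (simp add: conv_distrib algebra_simps)
  \<comment> \<open>By \<open>inflate_conv\<close> the second factor gets projected, and that
    produces the factor \<open>card H\<close>.\<close>
  also have "inflate y \<star> inflate y' = inflate (frag_cmul ?n (y \<star>\<^sub>Q y'))"
    using y by (simp add: inflate_conv project_inflate)
  also have "inflate y + inflate y' + \<dots> = inflate ?s"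
    by simp
  finally have "(frag_of \<one> + inflate y) \<star> (frag_of \<one> + inflate y') = frag_of \<one>"
    unfolding s by simp
  then obtain x where x: "x \<in> carrier G"
    "frag_of \<one> + inflate y = frag_of x \<or> frag_of \<one> + inflate y = - frag_of x"
    using cut inflate_ZC y by (auto simp: cut_group_iff)
  have "project (frag_of \<one> + inflate y) = ?e + frag_cmul ?n y"
    using y by (simp add: project_inflate one_Q)
  then have "?e + frag_cmul ?n y = frag_of (H #> x) \<or> ?e + frag_cmul ?n y = - frag_of (H #> x)"
    using x(2) by (metis project_simps(2) project_simps(5))
  then show thesis
    using that[of "H #> x"] x(1) carrier_Q by blast
qed

end

section \<open>Assembling the argument for a central unit of the quotient ring\<close>

theorem theorem4:
  fixes G :: "('a, 'm) monoid_scheme"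
  assumes "cut_group G"
    and "N \<lhd> G"
    and "finite N"
  shows "cut_group (G Mod N)"
proof -
  interpret normal N G by fact
  interpret Q: group "G Mod N"
    by (rule factorgroup_is_group)
  let ?e = "frag_of \<one>\<^bsub>G Mod N\<^esub>" and ?n = "int (card N)"
  note [simp] = Q.ZC_D(1) and [simp del] = one_FactGroup mult_FactGroup carrier_FactGroup
  have "\<exists>q \<in> carrier (G Mod N). u = frag_of q \<or> u = - frag_of q"
    if u: "u \<in> Q.ZC" and v: "v \<in> Q.ZC" and uv: "Q.conv u v = ?e" for u v
  proof -
    define s where "s = Q.conv u (Q.adj u)"
    define s' where "s' = Q.conv v (Q.adj v)"
    have s: "s \<in> Q.ZC" and s': "s' \<in> Q.ZC"
      using u v by (simp_all add: s_def s'_def)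
    have "Q.conv (Q.adj u) (Q.adj v) = Q.adj (Q.conv v u)"
      using u v by (simp add: Q.adj_conv)
    also have "Q.conv v u = ?e"
      using uv Q.ZC_D(2)[OF u, of v] v by simp
    finally have ss': "Q.conv s s' = ?e"
      using u v uv by (simp add: s_def s'_def Q.ZC_conv_conv[of u])
    let ?D = "Poly_Mapping.keys s"
    have D: "?D \<subseteq> carrier (G Mod N)"
      using s by (simp flip: Q.mem_ZG)
    \<comment> \<open>Passing from \<open>u\<close> to its norm replaces support elements by
      quotients of two of them, exactly the elements known to be torsion.\<close>
    have "\<exists>n\<ge>1. x [^]\<^bsub>G Mod N\<^esub> (n::nat) = \<one>\<^bsub>G Mod N\<^esub>" if x: "x \<in> ?D" for x
    proof -
      obtain a b where "x = a \<otimes>\<^bsub>G Mod N\<^esub> inv\<^bsub>G Mod N\<^esub> b"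
        "a \<in> Poly_Mapping.keys u" "b \<in> Poly_Mapping.keys u"
        using x Q.keys_conv[of u "Q.adj u"] Q.keys_adj[of u] unfolding s_def by blast
      then show ?thesis
        using Q.ZC_unit_keys_torsion[OF u v uv] by blast
    qed
    then have fin: "finite (generate (G Mod N) ?D)"
      using D Q.ZC_keys_conj[OF s] by (intro Q.finite_generate_normal_torsion) auto
    have "?n \<ge> 1"
      using \<open>finite N\<close> subgroup.one_closed[OF is_subgroup] card_gt_0_iff[of N] by fastforce
    moreover have "?D \<subseteq> generate (G Mod N) ?D"
      by (auto intro: generate.incl)
    ultimately obtain k y where k: "k \<ge> 1" and y: "y \<in> Q.ZC" and sk: "Q.zpow s k = ?e + frag_cmul ?n y"
      using Q.ZC_unit_pow_cong_1[OF s s' ss' Q.generate_is_subgroup[OF D] fin] by blast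
    \<comment> \<open>Chosen so that the inverse has the same shape: multiplying
      \<open>?e = Q.zpow s k - frag_cmul ?n y\<close> by \<open>Q.zpow s' k\<close> gives
      \<open>Q.zpow s' k = ?e + frag_cmul ?n y'\<close>.\<close>
    define y' where "y' = - Q.conv (Q.zpow s' k) y"
    have y': "y' \<in> Q.ZC"
      using s' y by (simp add: y'_def Q.ZC_minus_iff)
    have pows: "Q.conv (Q.zpow s k) (Q.zpow s' k) = ?e"
      by (rule Q.zpow_inverse[OF s s' ss'])
    have "Q.zpow s' k = Q.conv (Q.zpow s' k) (Q.zpow s k - frag_cmul ?n y)"
      using s' by (simp add: sk)
    also have "\<dots> = ?e + frag_cmul ?n y'"
      using pows s s' Q.ZC_D(2)[of "Q.zpow s k" "Q.zpow s' k"] by (simp add: Q.conv_distrib y'_def)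
    finally obtain q where q: "q \<in> carrier (G Mod N)" "Q.zpow s k = frag_of q \<or> Q.zpow s k = - frag_of q"
      using cut_group_lift_unit[OF assms(1,3) y y'] pows sk by metis
    have "u \<noteq> 0" using uv by auto
    have norm: "Q.zpow s k = Q.conv (Q.zpow u k) (Q.adj (Q.zpow u k))"
      unfolding s_def by (rule Q.ZC_norm_pow[OF u])
    have "Q.zpow u k \<noteq> 0"
      using Q.zpow_inverse[OF u v uv, of k] by auto
    then have "Q.trace (Q.zpow s k) \<ge> 1"
      unfolding norm using Q.trace_norm_pos u by simp
    \<comment> \<open>As the trace is positive, only the identity with a plus sign is
      possible.\<close>
    then have "Q.zpow s k = ?e"
      using q(2) by (auto split: if_splits)
    then have "s = ?e"
      using Q.ZC_norm_torsion[OF u k] by (simp add: s_def)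
    then have "Q.trace (Q.conv u (Q.adj u)) \<le> 1"
      by (simp add: s_def)
    then show ?thesis
      using Q.trace_conv_adj_le_1[of u] u \<open>u \<noteq> 0\<close> by (metis Q.ZC_D(1))
  qed
  then show ?thesis
    by (simp add: Q.cut_group_iff)
qed

end
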